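(* Let $d\in\mathbb{N}$. For any compact set $E\subset\mathbb{C}^d$ that is invariant under complex conjugation in each coordinate variable, we have \[ t_{\mathbb{Z}}(E) \leq (t_{\mathbb{C}}(E))^{d/(d+1)}, \] where $t_{\mathbb{Z}}(E)$ is the multivariate integer Chebyshev constant of $E$ and $t_{\mathbb{C}}(E)$ is the multivariate transfinite diameter of $E$.
   Context: $\mathbb{N}_0=\mathbb{N}\cup\{0\}$. For a multi-index $k=(k_1,\ldots,k_d)\in\mathbb{N}_0^d$ put $|k|=\sum_{i=1}^d k_i$ and $z^k=z_1^{k_1}\cdots z_d^{k_d}$ for $z\in\mathbb{C}^d$. $\mathcal{P}_n^d(\mathbb{Z})$ is the set of polynomials $\sum_{|k|\le n}a_kz^k$ in $d$ variables of (total) degree at most $n$ with integer coefficients $a_k$. For compact $E\subset\mathbb{C}^d$, $\|f\|_E:=\sup_{z\in E}|f(z)|$. Integer Chebyshev constant: $t_{\mathbb{Z}}(n,E):=\inf\{\|P\|_E: P\in\mathcal{P}_n^d(\mathbb{Z}),\ P\not\equiv 0\}$ and $t_{\mathbb{Z}}(E):=\lim_{n\to\infty}t_{\mathbb{Z}}(n,E)^{1/n}$. Transfinite diameter: let $h_n:=\binom{d+n}{n}$ be the number of multi-indices $k\in\mathbb{N}_0^d$ with $|k|\le n$, enumerated as $k^{(1)},\ldots,k^{(h_n)}$ (the order affects only signs below). For $z_1,\ldots,z_{h_n}\in\mathbb{C}^d$ define the Vandermonde determinant $V(z_1,\ldots,z_{h_n}):=\det\big(z_i^{k^{(j)}}\big)_{i,j=1}^{h_n}$.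 Let $\zeta_1,\ldots,\zeta_{h_n}\in E$ (depending on $n$) be $n$th Fekete points of $E$, i.e. points with $|V(\zeta_1,\ldots,\zeta_{h_n})|=\max_{z_1,\ldots,z_{h_n}\in E}|V(z_1,\ldots,z_{h_n})|$. Let $l_n:=d\binom{d+n}{d+1}$, and define $t_{\mathbb{C}}(E):=\lim_{n\to\infty}|V(\zeta_1,\ldots,\zeta_{h_n})|^{1/l_n}$ (the existence of this limit for every compact $E$ is a known fact). Invariance under complex conjugation in each coordinate variable means: for each $j=1,\ldots,d$, if $(z_1,\ldots,z_j,\ldots,z_d)\in E$ then $(z_1,\ldots,\overline{z_j},\ldots,z_d)\in E$. *)

theory Defs
  imports "HOL-Analysis.Analysis" "Jordan_Normal_Form.Determinant"
begin

no_notation vec_index (infixl "$" 100)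

(* The dimension d is CARD('d). Multi-indices are vectors of type nat ^ 'd. *)

definition mi_abs :: "nat ^ 'd \<Rightarrow> nat" where
  "mi_abs k = (\<Sum>i\<in>UNIV. k $ i)"

definition multi_indices :: "nat \<Rightarrow> (nat ^ 'd) set" where
  "multi_indices n = {k. mi_abs k \<le> n}"

definition mpow :: "complex ^ 'd \<Rightarrow> nat ^ 'd \<Rightarrow> complex" where
  "mpow z k = (\<Prod>i\<in>UNIV. (z $ i) ^ (k $ i))"

subsection \<open>Integer Chebyshev constant\<close>

(* Polynomials are represented by the functions they induce on the whole space. Since the field
   of complex numbers is infinite, a polynomial is nonzero iff the function is nonzero. *)
definition int_polys :: "nat \<Rightarrow> (complex ^ 'd \<Rightarrow> complex) set" where
  "int_polys n = {P. \<exists>a :: nat ^ 'd \<Rightarrow> int.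
     P = (\<lambda>z. \<Sum>k\<in>multi_indices n. of_int (a k) * mpow z k)}"

definition sup_norm_on :: "(complex ^ 'd) set \<Rightarrow> (complex ^ 'd \<Rightarrow> complex) \<Rightarrow> real" where
  "sup_norm_on E f = (SUP z\<in>E. cmod (f z))"

definition int_chebyshev_n :: "nat \<Rightarrow> (complex ^ 'd) set \<Rightarrow> real" where
  "int_chebyshev_n n E = Inf {sup_norm_on E P |P. P \<in> int_polys n \<and> P \<noteq> (\<lambda>z. 0)}"

definition int_chebyshev :: "(complex ^ 'd) set \<Rightarrow> real" where
  "int_chebyshev E = lim (\<lambda>n. root n (int_chebyshev_n n E))"

subsection \<open>Transfinite diameter\<close>

definition num_mi :: "nat \<Rightarrow> nat \<Rightarrow> nat" where
  "num_mi d n = (d + n) choose n"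

(* An arbitrary enumeration of the multi-indices; it exists by card_multi_indices below.
   A different choice only permutes the columns of the Vandermonde matrix. *)
definition mi_enum :: "nat \<Rightarrow> nat \<Rightarrow> nat ^ 'd" where
  "mi_enum n = (SOME e. bij_betw e {..<num_mi CARD('d) n} (multi_indices n))"

(* Here and below only the values of z on {..<num_mi CARD('d) n} matter: indices start at 0. *)
definition vandermonde :: "nat \<Rightarrow> (nat \<Rightarrow> complex ^ 'd) \<Rightarrow> complex" where
  "vandermonde n z = Determinant.det (Matrix.mat (num_mi CARD('d) n) (num_mi CARD('d) n)
     (\<lambda>(i, j). mpow (z i) (mi_enum n j)))"

definition fekete_points :: "nat \<Rightarrow> (complex ^ 'd) set \<Rightarrow> (nat \<Rightarrow> complex ^ 'd) \<Rightarrow> bool" where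
  "fekete_points n E \<zeta> \<longleftrightarrow>
     (\<forall>i<num_mi CARD('d) n. \<zeta> i \<in> E) \<and>
     (\<forall>z. (\<forall>i<num_mi CARD('d) n. z i \<in> E) \<longrightarrow> cmod (vandermonde n z) \<le> cmod (vandermonde n \<zeta>))"

definition mi_degree_sum :: "nat \<Rightarrow> nat \<Rightarrow> nat" where
  "mi_degree_sum d n = d * ((d + n) choose (d + 1))"

(* Fekete points exist for every nonempty compact E, and the modulus of the Vandermonde
   determinant does not depend on which ones are chosen. *)
definition transfinite_diameter :: "(complex ^ 'd) set \<Rightarrow> real" where
  "transfinite_diameter E =
     lim (\<lambda>n. root (mi_degree_sum CARD('d) n) (cmod (vandermonde n (SOME \<zeta>. fekete_points n E \<zeta>))))"

subsection \<open>Coordinatewise conjugation\<close>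

definition conj_coord :: "'d \<Rightarrow> complex ^ 'd \<Rightarrow> complex ^ 'd" where
  "conj_coord j z = (\<chi> i. if i = j then cnj (z $ i) else z $ i)"

definition conj_invariant :: "(complex ^ 'd) set \<Rightarrow> bool" where
  "conj_invariant E \<longleftrightarrow> (\<forall>j. \<forall>z\<in>E. conj_coord j z \<in> E)"

subsection \<open>The number of multi-indices\<close>

lemma card_functions_bounded_sum:
  assumes "finite S"
  shows "finite {f :: 'a \<Rightarrow> nat. (\<forall>i. i \<notin> S \<longrightarrow> f i = 0) \<and> sum f S \<le> n} \<and>
     card {f :: 'a \<Rightarrow> nat. (\<forall>i. i \<notin> S \<longrightarrow> f i = 0) \<and> sum f S \<le> n} = (card S + n) choose n"
  using assms
proof (induction S arbitrary: n rule: finite_induct)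
  case empty
  have "{f :: 'a \<Rightarrow> nat. (\<forall>i. i \<notin> {} \<longrightarrow> f i = 0) \<and> sum f {} \<le> n} = {\<lambda>_. 0}"
    by auto
  then show ?case by simp
next
  case (insert a S)
  define A where "A m = {f :: 'a \<Rightarrow> nat. (\<forall>i. i \<notin> S \<longrightarrow> f i = 0) \<and> sum f S \<le> m}" for m
  define B where "B = {f :: 'a \<Rightarrow> nat. (\<forall>i. i \<notin> insert a S \<longrightarrow> f i = 0) \<and> sum f (insert a S) \<le> n}"
  have fA: "finite (A m)" and cA: "card (A m) = (card S + m) choose m" for m
    using insert.IH[of m] unfolding A_def by auto
  have sum_upd: "(\<Sum>x\<in>S. if x = a then m else f x) = sum f S" for f :: "'a \<Rightarrow> nat" and m
    using insert.hyps by (intro sum.cong) auto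
  have bij: "bij_betw (\<lambda>(m, f). f(a := n - m)) (Sigma {..n} A) B"
  proof (rule bij_betw_byWitness[where f' = "\<lambda>f. (n - f a, f(a := 0))"])
    show "\<forall>p\<in>Sigma {..n} A. (\<lambda>f. (n - f a, f(a := 0))) ((\<lambda>(m, f). f(a := n - m)) p) = p"
      using insert.hyps by (auto simp: A_def fun_eq_iff)
    show "\<forall>f\<in>B. (\<lambda>(m, f). f(a := n - m)) ((\<lambda>f. (n - f a, f(a := 0))) f) = f"
      using insert.hyps by (auto simp: B_def fun_eq_iff)
    show "(\<lambda>(m, f). f(a := n - m)) ` Sigma {..n} A \<subseteq> B"
      using insert.hyps by (auto simp: A_def B_def sum_upd)
    show "(\<lambda>f. (n - f a, f(a := 0))) ` B \<subseteq> Sigma {..n} A"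
      using insert.hyps by (auto simp: A_def B_def sum_upd)
  qed
  have "finite B"
    using bij_betw_finite[OF bij] fA by auto
  moreover have "card B = (\<Sum>m\<le>n. (card S + m) choose m)"
    using bij_betw_same_card[OF bij] fA by (simp add: cA)
  then have "card B = (card (insert a S) + n) choose n"
    using insert.hyps sum_choose_lower[of "card S" n] by simp
  ultimately show ?case unfolding B_def by auto
qed

lemma card_multi_indices:
  "finite (multi_indices n :: (nat ^ 'd) set)"
  "card (multi_indices n :: (nat ^ 'd) set) = num_mi CARD('d) n"
proof -
  define A where "A = {f :: 'd \<Rightarrow> nat. (\<forall>i. i \<notin> UNIV \<longrightarrow> f i = 0) \<and> sum f UNIV \<le> n}"
  have bij: "bij_betw vec_nth (multi_indices n :: (nat ^ 'd) set) A"
    by (rule bij_betw_byWitness[where f' = vec_lambda])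
       (auto simp: A_def multi_indices_def mi_abs_def)
  show "finite (multi_indices n :: (nat ^ 'd) set)"
    using bij_betw_finite[OF bij] card_functions_bounded_sum[of "UNIV :: 'd set" n]
    unfolding A_def by auto
  show "card (multi_indices n :: (nat ^ 'd) set) = num_mi CARD('d) n"
    using bij_betw_same_card[OF bij] card_functions_bounded_sum[of "UNIV :: 'd set" n]
    unfolding A_def num_mi_def by auto
qed

lemma bij_betw_mi_enum:
  "bij_betw (mi_enum n) {..<num_mi CARD('d) n} (multi_indices n :: (nat ^ 'd) set)"
proof -
  have "\<exists>e. bij_betw e {..<num_mi CARD('d) n} (multi_indices n :: (nat ^ 'd) set)"
    using ex_bij_betw_nat_finite[OF card_multi_indices(1)[where 'd = 'd, of n]]
    by (simp add: card_multi_indices(2) lessThan_atLeast0)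
  then show ?thesis
    unfolding mi_enum_def by (rule someI_ex)
qed

end

theory Submission
  imports Defs "HOL-Real_Asymp.Real_Asymp"
begin

text \<open>
  Write \<open>h\<close> for the number of monomials of degree at most \<open>n\<close> in \<open>d\<close> variables, \<open>l\<close> for the sum of their
  degrees, \<open>V\<close> for the largest modulus of the Vandermonde determinant on \<open>E\<close>, and \<open>t\<close> for the \<open>n\<close>th
  integer Chebyshev number of \<open>E\<close>. The theorem is the limit of the effective inequality
  \<open>t \<le> 4 h^2 V^(1/h)\<close> (\<open>int_chebyshev_n_le_fekete_max\<close>): since \<open>(d + 1) l = d n h\<close>, the \<open>n\<close>th root of
  \<open>V^(1/h)\<close> is the power with exponent \<open>d/(d + 1)\<close> of \<open>V^(1/l)\<close>, while \<open>h\<close> grows polynomially in \<open>n\<close> and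
  disappears under \<open>n\<close>th roots.

  The effective inequality is an application of Minkowski's theorem on linear forms. The real and the
  imaginary part of \<open>P(z)\<close>, for a point \<open>z\<close> of \<open>E\<close> and a polynomial \<open>P\<close> with integer coefficients, are
  real linear forms in the coefficients of \<open>P\<close>. Because \<open>E\<close> is closed under conjugation, the coefficient
  vectors of these forms are, up to unimodular factors, means of two vectors of monomial values at
  points of \<open>E\<close>; expanding a determinant of \<open>h\<close> such forms row by row shows that it is at most \<open>V\<close>
  (\<open>det_of_real_forms_le_fekete_max\<close>). A bound for all these determinants suffices for a nonzero
  integer vector at which every form of the family is small (\<open>small_integer_combination\<close>).

  Both constants are defined as limits, so their existence has to be established as well. In both
  cases each term of the sequence bounds the later ones asymptotically, and this self-improvement
  forces convergence (\<open>convergent_if_dominated_by_each_term\<close>). For the integer Chebyshev constant the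
  improvement is obtained by taking powers of a polynomial. For the transfinite diameter, where the
  existence of the limit is Zaharjuta's theorem, it is the inequality \<open>fekete_max_self_improvement\<close>.
  There \<open>V\<close> is compared with a product of norms of polynomials, one with leading monomial \<open>z^k\<close> for each
  multi-index \<open>k\<close> of degree at most \<open>n\<close>: every choice of such polynomials gives an upper bound for \<open>V\<close>
  up to the factor \<open>h!\<close> (\<open>max_vdm_le_prod_monic\<close>), and for some choice the product is at most \<open>V\<close>
  (\<open>ex_monic_with_prod_le_max_vdm\<close>). From the polynomials \<open>p\<^sub>a\<close> of such a choice for degree \<open>M\<close> one gets
  polynomials \<open>p\<^sub>a^q z^r\<close> for a degree \<open>N\<close> slightly larger than \<open>q M\<close>, by writing each multi-index as
  \<open>k = q a + r\<close> with all components of \<open>r\<close> below \<open>q\<close>.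
\<close>

section \<open>Determinants of arrays\<close>

text \<open>
  Rows are functions on the natural numbers, so that a row can be exchanged by function update and an
  array of vectors from any set of functions is again such an array.
\<close>

definition det_of :: "nat \<Rightarrow> (nat \<Rightarrow> nat \<Rightarrow> 'a) \<Rightarrow> 'a::comm_ring_1" where
  "det_of n f = Determinant.det (Matrix.mat n n (\<lambda>(i, j). f i j))"

lemma det_of_leibniz:
  "det_of n f = (\<Sum>p | p permutes {0..<n}. signof p * (\<Prod>i=0..<n. f i (p i)))"
proof -
  have "p i < n" if "p permutes {0..<n}" "i < n" for p and i :: nat
    using permutes_in_image[OF that(1)] that(2) by fastforce
  then show ?thesis
    unfolding det_of_def
    by (subst det_def'[of _ n]) (auto intro!: sum.cong prod.cong)
qed

lemma det_of_cong:
  assumes "\<And>i j. i < n \<Longrightarrow> j < n \<Longrightarrow> f i j = g i j"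
  shows "det_of n f = det_of n g"
  unfolding det_of_def by (rule arg_cong[where f = Determinant.det]) (auto simp: assms)

lemma det_of_0 [simp]: "det_of 0 f = 1"
  unfolding det_of_def by simp

lemma det_of_transpose: "det_of n (\<lambda>i j. f j i) = det_of n f"
proof -
  have "Matrix.mat n n (\<lambda>(i, j). f j i) = transpose_mat (Matrix.mat n n (\<lambda>(i, j). f i j))"
    by auto
  then show ?thesis
    unfolding det_of_def by (metis det_transpose mat_carrier)
qed

lemma det_of_mult: "det_of n (\<lambda>i j. \<Sum>k<n. f i k * g k j) = det_of n f * det_of n g"
proof -
  have "Matrix.mat n n (\<lambda>(i, j). \<Sum>k<n. f i k * g k j) =
      Matrix.mat n n (\<lambda>(i, j). f i j) * Matrix.mat n n (\<lambda>(i, j). g i j)"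
    by (rule eq_matI) (auto simp: scalar_prod_def lessThan_atLeast0)
  then show ?thesis
    unfolding det_of_def by (metis det_mult mat_carrier)
qed

lemma det_of_lower_triangular:
  assumes "\<And>i j. i < j \<Longrightarrow> j < n \<Longrightarrow> f i j = 0"
  shows "det_of n f = (\<Prod>i<n. f i i)"
  unfolding det_of_def
  by (subst det_lower_triangular[of n])
     (auto simp: assms prod_list_diag_prod lessThan_atLeast0 intro!: prod.cong)

lemma det_of_permute_rows:
  assumes "p permutes {0..<n}"
  shows "det_of n (\<lambda>i j. f (p i) j) = signof p * det_of n f"
proof -
  have "p i < n" if "i < n" for i
    using permutes_in_image[OF assms] that by fastforce
  then have "Matrix.mat n n (\<lambda>(i, j). f (p i) j) =
      Matrix.mat n n (\<lambda>(i, j). Matrix.mat n n (\<lambda>(i, j). f i j) $$ (p i, j))"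
    by (intro eq_matI) auto
  then show ?thesis
    unfolding det_of_def by (simp add: det_permute_rows[OF _ assms])
qed

text \<open>
  The column with index \<open>i\<close> of the adjugate holds the cofactors of row \<open>i\<close>. These do not involve row \<open>i\<close>
  itself, which gives the third equation: the determinant is linear in each row, with the adjugate
  as coefficients.
\<close>

lemma adjugate:
  fixes f :: "nat \<Rightarrow> nat \<Rightarrow> 'a::comm_ring_1"
  obtains g where
    "\<And>i j. i < n \<Longrightarrow> j < n \<Longrightarrow> (\<Sum>k<n. f i k * g k j) = (if i = j then det_of n f else 0)"
    "\<And>i j. i < n \<Longrightarrow> j < n \<Longrightarrow> (\<Sum>k<n. g i k * f k j) = (if i = j then det_of n f else 0)"
    "\<And>v i. i < n \<Longrightarrow> det_of n (f(i := v)) = (\<Sum>k<n. v k * g k i)"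
proof
  let ?A = "Matrix.mat n n (\<lambda>(i, j). f i j)"
  let ?g = "\<lambda>i j. cofactor ?A j i"
  have A: "?A \<in> carrier_mat n n" by simp
  show "(\<Sum>k<n. f i k * ?g k j) = (if i = j then det_of n f else 0)" if "i < n" "j < n" for i j
  proof -
    have "(?A * adj_mat ?A) $$ (i, j) = (\<Sum>k<n. f i k * ?g k j)"
      using that by (simp add: adj_mat_def scalar_prod_def lessThan_atLeast0)
    then show ?thesis
      unfolding adj_mat(2)[OF A] using that by (auto simp: det_of_def)
  qed
  show "(\<Sum>k<n. ?g i k * f k j) = (if i = j then det_of n f else 0)" if "i < n" "j < n" for i j
  proof -
    have "(adj_mat ?A * ?A) $$ (i, j) = (\<Sum>k<n. ?g i k * f k j)"
      using that by (simp add: adj_mat_def scalar_prod_def lessThan_atLeast0)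
    then show ?thesis
      unfolding adj_mat(3)[OF A] using that by (auto simp: det_of_def)
  qed
  show "det_of n (f(i := v)) = (\<Sum>k<n. v k * ?g k i)" if "i < n" for v i
  proof -
    let ?B = "Matrix.mat n n (\<lambda>(i', j). (f(i := v)) i' j)"
    have "mat_delete ?B i j = mat_delete ?A i j" if "j < n" for j
      unfolding mat_delete_def using \<open>i < n\<close> that by (intro eq_matI) auto
    then have "cofactor ?B i j = cofactor ?A i j" if "j < n" for j
      using that by (simp add: cofactor_def)
    then show ?thesis
      unfolding det_of_def
      by (subst laplace_expansion_row[of _ n i]) (use that in \<open>auto simp del: fun_upd_apply, simp\<close>)
  qed
qed

lemma det_of_row_linear:
  assumes "i < n"
  shows "det_of n (f(i := \<lambda>j. a * u j + b * v j)) =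
    a * det_of n (f(i := u)) + b * det_of n (f(i := v))"
proof -
  obtain g where "\<And>v. det_of n (f(i := v)) = (\<Sum>k<n. v k * g k i)"
    using adjugate[of n f] assms by metis
  then show ?thesis
    by (simp add: sum_distrib_left sum.distrib algebra_simps)
qed

text \<open>
  Cramer's rule without division. It is applied to rows of maximal determinant within a family of
  vectors: then any member \<open>v\<close> of the family is a combination of these rows with coefficients of
  modulus at most 1.
\<close>

lemma cramer_rows:
  assumes "j < n"
  shows "det_of n f * v j = (\<Sum>i<n. det_of n (f(i := v)) * f i j)"
proof -
  obtain g where g: "\<And>i j. i < n \<Longrightarrow> j < n \<Longrightarrow>
      (\<Sum>k<n. g i k * f k j) = (if i = j then det_of n f else 0)"
    and e: "\<And>v i. i < n \<Longrightarrow> det_of n (f(i := v)) = (\<Sum>k<n. v k * g k i)"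
    by (rule adjugate[of n f]) blast
  have "(\<Sum>i<n. det_of n (f(i := v)) * f i j) = (\<Sum>i<n. \<Sum>k<n. v k * (g k i * f i j))"
    by (simp add: e sum_distrib_right mult.assoc)
  also have "\<dots> = (\<Sum>k<n. v k * (\<Sum>i<n. g k i * f i j))"
    by (subst sum.swap) (simp add: sum_distrib_left)
  also have "\<dots> = (\<Sum>k<n. if k = j then v j * det_of n f else 0)"
    using assms by (intro sum.cong) (auto simp: g)
  also have "\<dots> = det_of n f * v j"
    using assms by (simp add: mult.commute)
  finally show ?thesis ..
qed

lemma det_of_of_real: "det_of n (\<lambda>i j. complex_of_real (f i j)) = complex_of_real (det_of n f)"
  by (simp add: det_of_leibniz sign_def of_int_sum) 

lemma det_of_of_int: "det_of n (\<lambda>i j. of_int (f i j)) = of_int (det_of n f)"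
  by (simp add: det_of_leibniz)

section \<open>Small values of integer linear forms\<close>

text \<open>
  Division with remainder, coordinate by coordinate: as \<open>t\<close> is lower triangular, the choice of \<open>c j\<close>
  does not affect the coordinates before \<open>j\<close>.
\<close>

lemma reduce_lower_triangular:
  fixes t :: "nat \<Rightarrow> nat \<Rightarrow> int"
  assumes "\<And>i. i < n \<Longrightarrow> t i i > 0" and "\<And>i j. i < j \<Longrightarrow> j < n \<Longrightarrow> t i j = 0"
  shows "\<exists>c. \<forall>i<n. y i - (\<Sum>j<n. t i j * c j) \<in> {0..<t i i}"
proof -
  have "\<exists>c. \<forall>i<m. y i - (\<Sum>j<m. t i j * c j) \<in> {0..<t i i}" if "m \<le> n" for m
    using that
  proof (induction m)
    case (Suc m)
    then obtain c where c: "\<forall>i<m. y i - (\<Sum>j<m. t i j * c j) \<in> {0..<t i i}" by auto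
    define q where "q = (y m - (\<Sum>j<m. t m j * c j)) div t m m"
    have eq: "(\<Sum>j<m. t i j * (c(m := q)) j) = (\<Sum>j<m. t i j * c j)" for i
      by (intro sum.cong) auto
    have "y m - (\<Sum>j<m. t m j * c j) - t m m * q = (y m - (\<Sum>j<m. t m j * c j)) mod t m m"
      unfolding q_def by (simp add: minus_mult_div_eq_mod)
    then have m: "y m - (\<Sum>j<m. t m j * c j) - t m m * q \<in> {0..<t m m}"
      using assms(1)[of m] Suc.prems by simp
    have "y i - (\<Sum>j<Suc m. t i j * (c(m := q)) j) \<in> {0..<t i i}" if "i < Suc m" for i
    proof (cases "i = m")
      case True
      then show ?thesis using m by (simp only: sum.lessThan_Suc eq) (simp add: algebra_simps)
    next
      case False
      then have "i < m" using that by simp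
      then show ?thesis using c assms(2)[of i m] Suc.prems
        by (simp only: sum.lessThan_Suc eq) auto
    qed
    then show ?case by blast
  qed auto
  then show ?thesis by blast
qed

text \<open>
  The Hermite normal form of the lattice generated by the columns of \<open>a\<close>, without elementary
  operations. Among the lattice vectors that vanish before coordinate \<open>i\<close> and are positive there (a
  multiple of the unit vector is one, by the adjugate), column \<open>i\<close> of \<open>t\<close> is one with the least \<open>i\<close>th
  coordinate. These columns generate the lattice, so \<open>a\<close> is \<open>t\<close> times an integer array, and
  the determinant of \<open>t\<close> divides that of \<open>a\<close>.
\<close>

lemma triangular_lattice_basis:
  fixes a :: "nat \<Rightarrow> nat \<Rightarrow> int"
  assumes "det_of n a \<noteq> 0"
  obtains t :: "nat \<Rightarrow> nat \<Rightarrow> int" and x :: "nat \<Rightarrow> nat \<Rightarrow> int" where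
    "\<And>i j. i < n \<Longrightarrow> j < n \<Longrightarrow> t i j = (\<Sum>k<n. a i k * x k j)"
    "\<And>i. i < n \<Longrightarrow> t i i > 0" "\<And>i j. i < j \<Longrightarrow> j < n \<Longrightarrow> t i j = 0"
    "(\<Prod>i<n. t i i) \<le> \<bar>det_of n a\<bar>"
proof -
  define L where "L x = (\<lambda>i. \<Sum>k<n. a i k * x k)" for x
  define P where "P i g \<longleftrightarrow> g > 0 \<and> (\<exists>x. L x i = int g \<and> (\<forall>j<i. L x j = 0))" for i g
  obtain b where b: "\<And>i j. i < n \<Longrightarrow> j < n \<Longrightarrow>
      (\<Sum>k<n. a i k * b k j) = (if i = j then det_of n a else 0)"
    by (rule adjugate[of n a]) blast
  have "\<exists>g. P i g" if "i < n" for i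
  proof -
    have "L (\<lambda>k. sgn (det_of n a) * b k i) j = sgn (det_of n a) * (\<Sum>k<n. a j k * b k i)" for j
      by (simp add: L_def sum_distrib_left mult.left_commute)
    then have "L (\<lambda>k. sgn (det_of n a) * b k i) j = (if j = i then \<bar>det_of n a\<bar> else 0)"
      if "j < n" for j
      using that \<open>i < n\<close> by (simp add: b abs_sgn mult.commute)
    then have "P i (nat \<bar>det_of n a\<bar>)"
      unfolding P_def using that assms
      by (intro conjI exI[of _ "\<lambda>k. sgn (det_of n a) * b k i"]) auto
    then show ?thesis ..
  qed
  then have "\<forall>i<n. P i (LEAST g. P i g)" by (blast intro: LeastI)
  then have "\<forall>i. \<exists>x. i < n \<longrightarrow> L x i = int (LEAST g. P i g) \<and> (LEAST g. P i g) > 0 \<and> (\<forall>j<i. L x j = 0)"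
    unfolding P_def by blast
  then obtain X where X: "\<And>i. i < n \<Longrightarrow> L (X i) i = int (LEAST g. P i g)"
    "\<And>i. i < n \<Longrightarrow> (LEAST g. P i g) > 0" "\<And>i j. i < n \<Longrightarrow> j < i \<Longrightarrow> L (X i) j = 0"
    by metis
  define t where "t i j = L (X j) i" for i j
  have t_pos: "t i i > 0" if "i < n" for i
    using X(1,2)[OF that] by (simp add: t_def)
  have t_tri: "t i j = 0" if "i < j" "j < n" for i j
    using X(3)[OF that(2,1)] by (simp add: t_def)
  \<comment> \<open>Every lattice vector reduces to zero, since by minimality its remainder has no first
    nonzero coordinate.\<close>
  have gen: "\<exists>c. \<forall>i<n. L v i = (\<Sum>j<n. t i j * c j)" for v
  proof -
    obtain c where c: "\<forall>i<n. L v i - (\<Sum>j<n. t i j * c j) \<in> {0..<t i i}"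
      using reduce_lower_triangular[of n t "L v"] t_pos t_tri by blast
    define w where "w = (\<lambda>k. v k - (\<Sum>j<n. X j k * c j))"
    have "(\<Sum>k<n. a i k * (\<Sum>j<n. X j k * c j)) = (\<Sum>j<n. t i j * c j)" for i
      unfolding t_def L_def sum_distrib_left sum_distrib_right
      by (subst sum.swap) (simp add: mult.assoc)
    then have w: "L w i = L v i - (\<Sum>j<n. t i j * c j)" for i
      unfolding w_def by (simp add: L_def algebra_simps sum_subtractf)
    have "L w i = 0" if "i < n" for i
      using that
    proof (induction i rule: less_induct)
      case (less i)
      have "L w i \<in> {0..<t i i}" using c less.prems w by simp
      moreover have "P i (nat (L w i))" if "L w i > 0"
        unfolding P_def using that less by (auto intro!: exI[of _ w])
      ultimately show ?case
        using Least_le[of "P i" "nat (L w i)"] X(1)[OF less.prems] by (force simp: t_def)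
    qed
    then show ?thesis using w by (intro exI[of _ c]) auto
  qed
  have "\<exists>c. \<forall>i<n. a i j = (\<Sum>k<n. t i k * c k)" if "j < n" for j
  proof -
    have "L (\<lambda>k. if k = j then 1 else 0) i = a i j" for i
    proof -
      have "L (\<lambda>k. if k = j then 1 else 0) i = (\<Sum>k<n. if k = j then a i j else 0)"
        unfolding L_def by (intro sum.cong) auto
      then show ?thesis using that by simp
    qed
    then show ?thesis using gen[of "\<lambda>k. if k = j then 1 else 0"] by simp
  qed
  then have "\<forall>j. \<exists>c. j < n \<longrightarrow> (\<forall>i<n. a i j = (\<Sum>k<n. t i k * c k))" by blast
  then obtain y where y: "\<And>i j. i < n \<Longrightarrow> j < n \<Longrightarrow> a i j = (\<Sum>k<n. t i k * y j k)"
    by metis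
  have "det_of n a = det_of n (\<lambda>i j. \<Sum>k<n. t i k * y j k)"
    by (rule det_of_cong) (rule y)
  also have "\<dots> = (\<Prod>i<n. t i i) * det_of n (\<lambda>i j. y j i)"
    using t_tri by (subst det_of_mult) (simp add: det_of_lower_triangular)
  finally have d: "det_of n a = (\<Prod>i<n. t i i) * det_of n (\<lambda>i j. y j i)" .
  then have "\<bar>det_of n (\<lambda>i j. y j i)\<bar> \<ge> 1" using assms by auto
  then have "(\<Prod>i<n. t i i) \<le> \<bar>det_of n a\<bar>"
    using mult_left_mono[of 1 "\<bar>det_of n (\<lambda>i j. y j i)\<bar>" "\<bar>\<Prod>i<n. t i i\<bar>"]
    unfolding d abs_mult by simp
  then show thesis
    using that[of t "\<lambda>k j. X j k"] t_pos t_tri by (simp add: t_def L_def)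
qed

text \<open>
  Minkowski's theorem on linear forms for integer coefficients, by counting residues instead of
  volumes. Modulo the lattice spanned by the columns of \<open>a\<close> every integer vector is congruent to one of
  at most \<open>\<bar>det_of n a\<bar>\<close> remainders, so two of the \<open>(s + 1) ^ n\<close> points of a box with side \<open>s\<close> are
  congruent. Their difference is the vector of values of the forms at an integer point.
\<close>

lemma integer_linear_forms:
  fixes a :: "nat \<Rightarrow> nat \<Rightarrow> int"
  assumes "det_of n a \<noteq> 0" and "\<bar>det_of n a\<bar> < (int s + 1) ^ n"
  shows "\<exists>x. (\<exists>j<n. x j \<noteq> 0) \<and> (\<forall>i<n. \<bar>\<Sum>j<n. a i j * x j\<bar> \<le> int s)"
proof -
  obtain t x where x: "\<And>i j. i < n \<Longrightarrow> j < n \<Longrightarrow> t i j = (\<Sum>k<n. a i k * x k j)"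
    and t: "\<And>i. i < n \<Longrightarrow> t i i > 0" "\<And>i j. i < j \<Longrightarrow> j < n \<Longrightarrow> t i j = 0"
    and pr: "(\<Prod>i<n. t i i) \<le> \<bar>det_of n a\<bar>"
    using triangular_lattice_basis[OF assms(1)] by blast
  define Y where "Y = PiE {..<n} (\<lambda>_. {0..int s})"
  define Z where "Z = PiE {..<n} (\<lambda>i. {0..<t i i})"
  have "\<exists>c. \<forall>i<n. y i - (\<Sum>j<n. t i j * c j) \<in> {0..<t i i}" for y
    using reduce_lower_triangular[of n t y] t by blast
  then obtain C where C: "\<And>y i. i < n \<Longrightarrow> y i - (\<Sum>j<n. t i j * C y j) \<in> {0..<t i i}"
    by metis
  define r where "r y = restrict (\<lambda>i. y i - (\<Sum>j<n. t i j * C y j)) {..<n}" for y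
  have "card Y = (s + 1) ^ n" by (simp add: Y_def card_PiE nat_add_distrib)
  moreover have "int (card Z) = (\<Prod>i<n. t i i)"
    using t(1) by (auto simp: Z_def card_PiE less_imp_le intro!: prod.cong)
  ultimately have "int (card Z) < int (card Y)" using pr assms(2) by (simp add: add.commute)
  moreover have "r ` Y \<subseteq> Z" using C by (force simp: r_def Z_def)
  moreover have "finite Z" by (auto simp: Z_def intro!: finite_PiE)
  ultimately have "\<not> inj_on r Y" using card_inj_on_le[of r Y Z] by auto
  then obtain u v where uv: "u \<in> Y" "v \<in> Y" "u \<noteq> v" "r u = r v" by (auto simp: inj_on_def)
  define w where "w = (\<lambda>k. \<Sum>j<n. x k j * (C u j - C v j))"
  have *: "(\<Sum>k<n. a i k * w k) = u i - v i" if "i < n" for i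
  proof -
    have "(\<Sum>k<n. a i k * w k) = (\<Sum>j<n. (\<Sum>k<n. a i k * x k j) * (C u j - C v j))"
      unfolding w_def sum_distrib_left sum_distrib_right
      by (subst sum.swap) (simp add: mult.assoc)
    also have "\<dots> = (\<Sum>j<n. t i j * (C u j - C v j))"
      using that by (intro sum.cong) (auto simp: x)
    also have "\<dots> = u i - v i"
      using that fun_cong[OF uv(4), of i] by (simp add: r_def right_diff_distrib sum_subtractf)
    finally show ?thesis .
  qed
  have "\<exists>i<n. u i \<noteq> v i"
    using uv by (auto simp: Y_def intro: PiE_ext)
  then have "\<exists>j<n. w j \<noteq> 0" using * by (metis (mono_tags, lifting) eq_iff_diff_eq_0 lessThan_iff mult_zero_right sum.neutral)
  moreover have "\<bar>u i - v i\<bar> \<le> int s" if "i < n" for i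
  proof -
    have "u i \<in> {0..int s}" "v i \<in> {0..int s}"
      using uv(1,2) that by (auto simp: Y_def PiE_iff)
    then show ?thesis by auto
  qed
  ultimately show ?thesis using * by auto
qed

lemma det_of_scale: "det_of n (\<lambda>i j. c * f i j) = c ^ n * det_of n f"
  by (simp add: det_of_leibniz prod.distrib sum_distrib_left mult.left_commute)

lemma det_of_perturbation:
  fixes f g :: "nat \<Rightarrow> nat \<Rightarrow> real"
  assumes f: "\<And>i j. i < n \<Longrightarrow> j < n \<Longrightarrow> \<bar>f i j\<bar> \<le> C"
    and g: "\<And>i j. i < n \<Longrightarrow> j < n \<Longrightarrow> \<bar>g i j\<bar> \<le> C"
    and fg: "\<And>i j. i < n \<Longrightarrow> j < n \<Longrightarrow> \<bar>f i j - g i j\<bar> \<le> e" and C: "C \<ge> 1"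
  shows "\<bar>det_of n f - det_of n g\<bar> \<le> fact n * (C ^ n * (real n * e))"
proof -
  have "\<bar>(\<Prod>i=0..<n. f i (p i)) - (\<Prod>i=0..<n. g i (p i))\<bar> \<le> C ^ n * (real n * e)"
    if "p permutes {0..<n}" for p
  proof -
    have p: "p i < n" if "i < n" for i
      using permutes_in_image[OF \<open>p permutes {0..<n}\<close>] that by fastforce
    have "norm ((\<Prod>i=0..<n. f i (p i) / C) - (\<Prod>i=0..<n. g i (p i) / C)) \<le>
        (\<Sum>i=0..<n. norm (f i (p i) / C - g i (p i) / C))"
      by (rule norm_prod_diff) (use p f g C in \<open>auto simp: divide_le_eq\<close>)
    also have "\<dots> \<le> (\<Sum>i=0..<n. e)"
    proof (rule sum_mono)
      fix i assume "i \<in> {0..<n}"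
      then have "\<bar>f i (p i) - g i (p i)\<bar> \<le> e" using p fg by simp
      moreover have "\<bar>f i (p i) - g i (p i)\<bar> / C \<le> \<bar>f i (p i) - g i (p i)\<bar> / 1"
        using C by (intro divide_left_mono) auto
      ultimately show "norm (f i (p i) / C - g i (p i) / C) \<le> e"
        using C by (simp add: abs_divide flip: diff_divide_distrib)
    qed
    finally have "\<bar>(\<Prod>i=0..<n. f i (p i)) - (\<Prod>i=0..<n. g i (p i))\<bar> / C ^ n \<le> real n * e"
      using C by (simp add: prod_dividef abs_divide flip: diff_divide_distrib)
    then show ?thesis using C by (simp add: divide_le_eq mult.commute)
  qed
  then have "\<bar>\<Sum>p | p permutes {0..<n}. signof p *
      ((\<Prod>i=0..<n. f i (p i)) - (\<Prod>i=0..<n. g i (p i)))\<bar> \<le>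
    (\<Sum>p | p permutes {0..<n}. C ^ n * (real n * e))"
    by (intro order_trans[OF sum_abs] sum_mono) (auto simp: abs_mult sign_def)
  then show ?thesis
    by (simp add: det_of_leibniz card_permutations[of _ n] right_diff_distrib sum_subtractf)
qed

text \<open>
  Minkowski's theorem for a whole family of real linear forms, in which every determinant is at most
  \<open>D\<close>. The forms are multiplied by a large integer \<open>q\<close> and rounded, and the unit vectors are added to the
  family. They make the largest determinant nonzero even if the given forms are dependent, and they
  bound the solution, so that rounding changes the values of the forms by a bounded factor only.
  Since a unit vector is within distance 1 of \<open>q\<close> times the zero vector, the largest determinant is
  at most \<open>q ^ n * (D + O(1 / q))\<close>, even where unit vectors take part.
  By Cramer's rule it suffices to make the \<open>n\<close> forms of largest determinant small.
\<close>

lemma small_integer_combination: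
  fixes K :: "(nat \<Rightarrow> real) set"
  assumes n: "n > 0"
    and C: "\<And>v j. v \<in> K \<Longrightarrow> j < n \<Longrightarrow> \<bar>v j\<bar> \<le> C"
    and D: "\<And>f. (\<And>i. i < n \<Longrightarrow> f i \<in> insert (\<lambda>_. 0) K) \<Longrightarrow> \<bar>det_of n f\<bar> \<le> D" and "D < D'"
  shows "\<exists>x :: nat \<Rightarrow> int. (\<exists>j<n. x j \<noteq> 0) \<and>
    (\<forall>v\<in>K. \<bar>\<Sum>j<n. v j * of_int (x j)\<bar> \<le> 2 * real n ^ 2 * root n D')"
proof -
  define C1 where "C1 = \<bar>C\<bar> + 1"
  have C1: "C1 \<ge> 1" "C + 1 \<le> C1" by (auto simp: C1_def)
  define M where "M = fact n * (C1 ^ n * real n)"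
  have M: "M \<ge> 0" using C1 by (auto simp: M_def)
  have D'_pos: "D' > 0" using D[of "\<lambda>_ _. 0"] \<open>D < D'\<close> by auto
  obtain q0 :: nat where q0: "M / (D' - D) \<le> real q0" using real_arch_simple by blast
  define q where "q = Suc q0"
  have q: "q \<ge> 1" by (simp add: q_def)
  have "M \<le> real q0 * (D' - D)" using q0 \<open>D < D'\<close> by (simp add: divide_le_eq)
  also have "\<dots> \<le> real q * (D' - D)" using \<open>D < D'\<close> by (intro mult_right_mono) (auto simp: q_def)
  finally have Mq: "M / real q \<le> D' - D" using q by (simp add: divide_le_eq mult.commute)
  \<comment> \<open>Rounded multiples of the given vectors, together with the vectors close to zero,
    among which are the unit vectors.\<close>
  define L where "L = {v :: nat \<Rightarrow> int. (\<exists>u\<in>insert (\<lambda>_. 0) K. \<forall>j<n. \<bar>v j - q * u j\<bar> \<le> 1) \<and>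
    (\<forall>j. j \<ge> n \<longrightarrow> v j = 0)}"
  have L_near: "\<exists>u\<in>insert (\<lambda>_. 0) K. \<forall>j<n. \<bar>v j - q * u j\<bar> \<le> 1" if "v \<in> L" for v
    using that unfolding L_def mem_Collect_eq by (rule conjunct1)
  have CK: "\<bar>u j\<bar> \<le> C1 - 1" if "u \<in> insert (\<lambda>_. 0) K" "j < n" for u j
    using that C[of u j] by (auto simp: C1_def)
  have L_le: "\<bar>real_of_int (v j)\<bar> \<le> real q * C1" if "v \<in> L" "j < n" for v j
  proof -
    from L_near[OF \<open>v \<in> L\<close>] obtain u :: "nat \<Rightarrow> real" where u: "u \<in> insert (\<lambda>_. 0) K"
      and un: "\<forall>j<n. \<bar>v j - q * u j\<bar> \<le> 1"
      by (rule bexE)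
    have "\<bar>real q * u j\<bar> \<le> real q * (C1 - 1)"
      unfolding abs_mult by (simp add: CK[OF u \<open>j < n\<close>] mult_left_mono)
    moreover have "\<bar>v j - q * u j\<bar> \<le> 1" using un \<open>j < n\<close> by simp
    ultimately show ?thesis using q by (simp add: right_diff_distrib)
  qed
  have "finite L"
  proof (rule finite_subset)
    show "L \<subseteq> {v. \<forall>j. (j \<in> {..<n} \<longrightarrow> v j \<in> {- \<lceil>q * C1\<rceil>..\<lceil>q * C1\<rceil>}) \<and> (j \<notin> {..<n} \<longrightarrow> v j = 0)}"
    proof (intro subsetI CollectI allI conjI impI)
      fix v j assume "v \<in> L" "j \<in> {..<n}"
      then have "v \<in> L" "j < n" by auto
      from L_le[OF this] show "v j \<in> {- \<lceil>q * C1\<rceil>..\<lceil>q * C1\<rceil>}"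
        by (auto simp: abs_le_iff) linarith+
    next
      fix v j assume "v \<in> L" "j \<notin> {..<n}"
      then show "v j = 0" unfolding L_def by auto
    qed
  qed (intro finite_set_of_finite_funs, auto)
  define F where "F = {f. \<forall>i. (i \<in> {..<n} \<longrightarrow> f i \<in> L) \<and> (i \<notin> {..<n} \<longrightarrow> f i = (\<lambda>_. 0))}"
  have "finite F"
    unfolding F_def by (intro finite_set_of_finite_funs \<open>finite L\<close>) auto
  have unit: "(\<lambda>j. if j = i then 1 else 0) \<in> L" if "i < n" for i
    using that by (auto simp: L_def intro!: bexI[of _ "\<lambda>_. 0"])
  define I where "I = (\<lambda>i j. if i < n \<and> j = i then 1 else 0 :: int)"
  have "I \<in> F" using unit by (auto simp: F_def I_def)
  have "det_of n I = (\<Prod>i<n. I i i)" by (rule det_of_lower_triangular) (auto simp: I_def)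
  then have det_I: "det_of n I = 1" by (simp add: I_def)
  obtain a where a: "a \<in> F" "\<And>f. f \<in> F \<Longrightarrow> \<bar>det_of n f\<bar> \<le> \<bar>det_of n a\<bar>"
  proof -
    have "Max ((\<lambda>f. \<bar>det_of n f\<bar>) ` F) \<in> (\<lambda>f. \<bar>det_of n f\<bar>) ` F"
      using \<open>finite F\<close> \<open>I \<in> F\<close> by (intro Max_in) auto
    then obtain a where "a \<in> F" "\<bar>det_of n a\<bar> = Max ((\<lambda>f. \<bar>det_of n f\<bar>) ` F)" by auto
    then show thesis using that[of a] \<open>finite F\<close> by (auto intro: Max_ge)
  qed
  have d_pos: "\<bar>det_of n a\<bar> \<ge> 1" using a(2)[OF \<open>I \<in> F\<close>] det_I by simp
  have d_le: "\<bar>det_of n a\<bar> \<le> real q ^ n * D'"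
  proof -
    have "\<forall>i\<in>{..<n}. \<exists>u :: nat \<Rightarrow> real. u \<in> insert (\<lambda>_. 0) K \<and> (\<forall>j<n. \<bar>a i j - q * u j\<bar> \<le> 1)"
    proof
      fix i assume "i \<in> {..<n}"
      then have "a i \<in> L" using a(1) by (simp add: F_def)
      from L_near[OF this] show "\<exists>u :: nat \<Rightarrow> real. u \<in> insert (\<lambda>_. 0) K \<and> (\<forall>j<n. \<bar>a i j - q * u j\<bar> \<le> 1)"
        by (rule bexE) (intro exI conjI)
    qed
    from bchoice[OF this] obtain u :: "nat \<Rightarrow> nat \<Rightarrow> real" where
      "\<forall>i\<in>{..<n}. u i \<in> insert (\<lambda>_. 0) K \<and> (\<forall>j<n. \<bar>a i j - q * u i j\<bar> \<le> 1)"
      by (rule exE)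
    then have u: "\<And>i. i < n \<Longrightarrow> u i \<in> insert (\<lambda>_. 0) K"
      "\<And>i j. i < n \<Longrightarrow> j < n \<Longrightarrow> \<bar>a i j - q * u i j\<bar> \<le> 1"
      by (simp_all del: insert_iff)
    have "\<bar>det_of n (\<lambda>i j. of_int (a i j) / real q) - det_of n u\<bar> \<le> fact n * (C1 ^ n * (real n * (1 / real q)))"
    proof (rule det_of_perturbation)
      fix i j assume ij: "i < n" "j < n"
      have aL: "a i \<in> L" using a(1) ij by (auto simp: F_def)
      show "\<bar>of_int (a i j) / real q\<bar> \<le> C1"
        using L_le[OF aL ij(2)] q by (simp add: abs_divide divide_le_eq mult.commute)
      show "\<bar>u i j\<bar> \<le> C1" using CK[OF u(1)[OF ij(1)] ij(2)] by simp
      have "of_int (a i j) / real q - u i j = (a i j - q * u i j) / real q"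
        using q by (simp add: field_simps)
      then show "\<bar>of_int (a i j) / real q - u i j\<bar> \<le> 1 / real q"
        using u(2)[OF ij] q by (simp add: abs_divide divide_right_mono)
    qed (rule C1)
    then have "\<bar>det_of n (\<lambda>i j. of_int (a i j) / real q) - det_of n u\<bar> \<le> M / real q"
      by (simp add: M_def)
    moreover have "\<bar>det_of n u\<bar> \<le> D" by (rule D) (rule u(1))
    ultimately have le: "\<bar>det_of n (\<lambda>i j. of_int (a i j) / real q)\<bar> \<le> D'"
      using Mq by linarith
    have "real_of_int (det_of n a) = det_of n (\<lambda>i j. real q * (of_int (a i j) / real q))"
      using q by (simp flip: det_of_of_int)
    also have "\<dots> = real q ^ n * det_of n (\<lambda>i j. of_int (a i j) / real q)"
      by (rule det_of_scale)
    finally show ?thesis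
      using mult_left_mono[OF le, of "real q ^ n"] by (simp add: abs_mult)
  qed
  \<comment> \<open>The least s that the pigeonhole argument admits; it satisfies s ^ n \<le> \<bar>det_of n a\<bar>.\<close>
  define s where "s = nat \<lfloor>root n \<bar>det_of n a\<bar>\<rfloor>"
  have s_le: "real s \<le> root n \<bar>det_of n a\<bar>" and s_gt: "root n \<bar>det_of n a\<bar> < real s + 1"
    using n by (auto simp: s_def)
  have "\<bar>real_of_int (det_of n a)\<bar> = root n \<bar>det_of n a\<bar> ^ n"
    using n by simp
  also have "\<dots> < (real s + 1) ^ n"
    using s_gt n by (intro power_strict_mono) auto
  finally have "real_of_int \<bar>det_of n a\<bar> < real_of_int ((int s + 1) ^ n)" by simp
  then have "\<bar>det_of n a\<bar> < (int s + 1) ^ n" by linarith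
  then obtain x where x0: "\<exists>j<n. x j \<noteq> 0"
    and xs: "\<And>i. i < n \<Longrightarrow> \<bar>\<Sum>j<n. a i j * x j\<bar> \<le> int s"
  proof -
    have "det_of n a \<noteq> 0" using d_pos by linarith
    then show thesis using integer_linear_forms[of n a s] that \<open>\<bar>det_of n a\<bar> < (int s + 1) ^ n\<close> by blast
  qed
  have form_le: "\<bar>\<Sum>j<n. v j * x j\<bar> \<le> int n * int s" if "v \<in> L" for v
  proof -
    have "det_of n a * (\<Sum>j<n. v j * x j) = (\<Sum>j<n. (det_of n a * v j) * x j)"
      by (simp add: sum_distrib_left mult.assoc)
    also have "\<dots> = (\<Sum>j<n. (\<Sum>i<n. det_of n (a(i := v)) * a i j) * x j)"
      by (rule sum.cong) (auto simp: cramer_rows)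
    also have "\<dots> = (\<Sum>i<n. det_of n (a(i := v)) * (\<Sum>j<n. a i j * x j))"
      unfolding sum_distrib_left sum_distrib_right by (subst sum.swap) (simp add: mult.assoc)
    finally have "\<bar>det_of n a\<bar> * \<bar>\<Sum>j<n. v j * x j\<bar> =
        \<bar>\<Sum>i<n. det_of n (a(i := v)) * (\<Sum>j<n. a i j * x j)\<bar>"
      unfolding abs_mult[symmetric] by (rule arg_cong)
    also have "\<dots> \<le> (\<Sum>i<n. \<bar>det_of n a\<bar> * int s)"
    proof (intro order_trans[OF sum_abs] sum_mono)
      fix i assume i: "i \<in> {..<n}"
      then have "a(i := v) \<in> F" using a(1) that by (auto simp: F_def)
      then show "\<bar>det_of n (a(i := v)) * (\<Sum>j<n. a i j * x j)\<bar> \<le> \<bar>det_of n a\<bar> * int s"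
        unfolding abs_mult using i xs a(2) by (intro mult_mono) auto
    qed
    finally have "\<bar>det_of n a\<bar> * \<bar>\<Sum>j<n. v j * x j\<bar> \<le> \<bar>det_of n a\<bar> * (int n * int s)"
      by (simp add: mult.left_commute)
    moreover have "\<bar>det_of n a\<bar> > 0" using d_pos by linarith
    ultimately show ?thesis by (simp only: mult_le_cancel_left_pos)
  qed
  have x_le: "\<bar>x j\<bar> \<le> int n * int s" if "j < n" for j
  proof -
    have "(\<Sum>k<n. (if k = j then 1 else 0) * x k) = (\<Sum>k<n. if k = j then x k else 0)"
      by (rule sum.cong) auto
    then show ?thesis using form_le[OF unit[OF that]] that by simp
  qed
  have x_le': "\<bar>real_of_int (x j)\<bar> \<le> real n * real s" if "j < n" for j
  proof -
    have "real_of_int \<bar>x j\<bar> \<le> real_of_int (int n * int s)"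
      unfolding of_int_le_iff by (rule x_le[OF that])
    then show ?thesis by simp
  qed
  have form_le': "\<bar>real_of_int (\<Sum>j<n. v j * x j)\<bar> \<le> real n * real s" if "v \<in> L" for v
  proof -
    have "real_of_int \<bar>\<Sum>j<n. v j * x j\<bar> \<le> real_of_int (int n * int s)"
      unfolding of_int_le_iff by (rule form_le[OF that])
    then show ?thesis by simp
  qed
  have "\<bar>\<Sum>j<n. v j * of_int (x j)\<bar> \<le> 2 * real n ^ 2 * root n D'" if "v \<in> K" for v
  proof -
    define w where "w = (\<lambda>j. if j < n then round (q * v j) else 0)"
    have w: "\<bar>w j - q * v j\<bar> \<le> 1" if "j < n" for j
      using that of_int_round_abs_le[of "q * v j"] by (simp add: w_def)
    then have "w \<in> L" using \<open>v \<in> K\<close> by (auto simp: L_def w_def)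
    have eq: "real q * (\<Sum>j<n. v j * of_int (x j)) =
        of_int (\<Sum>j<n. w j * x j) - (\<Sum>j<n. (w j - q * v j) * of_int (x j))"
      by (simp add: algebra_simps sum_subtractf sum_distrib_left)
    have "\<bar>\<Sum>j<n. (w j - q * v j) * of_int (x j)\<bar> \<le> (\<Sum>j<n. 1 * (real n * real s))"
    proof (intro order_trans[OF sum_abs] sum_mono)
      fix j assume "j \<in> {..<n}"
      then show "\<bar>(w j - q * v j) * of_int (x j)\<bar> \<le> 1 * (real n * real s)"
        unfolding abs_mult using w x_le'[of j] by (intro mult_mono) auto
    qed
    moreover have "\<bar>real_of_int (\<Sum>j<n. w j * x j)\<bar> \<le> real n * real s"
      by (rule form_le'[OF \<open>w \<in> L\<close>])
    ultimately have "real q * \<bar>\<Sum>j<n. v j * of_int (x j)\<bar> \<le> real n * real s + real n * (real n * real s)"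
      using arg_cong[OF eq, of abs] by (simp add: abs_mult)
    also have "\<dots> \<le> 2 * real n ^ 2 * real s"
    proof -
      have "real n * 1 \<le> real n * real n" using n by (intro mult_left_mono) auto
      then have "real n * real s \<le> real n * real n * real s" by (intro mult_right_mono) auto
      then show ?thesis by (simp add: power2_eq_square)
    qed
    also have "\<dots> \<le> 2 * real n ^ 2 * (real q * root n D')"
    proof (intro mult_left_mono)
      have "real s \<le> root n (real q ^ n * D')"
        using s_le d_le n by (meson order_trans real_root_le_mono)
      then show "real s \<le> real q * root n D'"
        using n by (simp add: real_root_mult real_root_power_cancel)
    qed auto
    finally have "real q * \<bar>\<Sum>j<n. v j * of_int (x j)\<bar> \<le> real q * (2 * real n ^ 2 * root n D')"
      by (simp add: mult_ac)
    moreover have "real q > 0" using q by simp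
    ultimately show ?thesis by (simp only: mult_le_cancel_left_pos)
  qed
  with x0 show ?thesis by blast
qed

section \<open>Multi-indices and polynomials\<close>

lemma mi_abs_add: "mi_abs (j + k) = mi_abs j + mi_abs k"
  by (simp add: mi_abs_def sum.distrib)

lemma mpow_add: "mpow z (j + k) = mpow z j * mpow z k"
  by (simp add: mpow_def power_add prod.distrib)

lemma sum_mi_abs:
  "(\<Sum>k\<in>(multi_indices n :: (nat ^ 'd) set). mi_abs k) = mi_degree_sum CARD('d) n"
proof (induction n)
  case 0
  have "multi_indices 0 = {k :: nat ^ 'd. mi_abs k = 0}" by (auto simp: multi_indices_def)
  then show ?case by (simp add: mi_degree_sum_def)
next
  case (Suc n)
  let ?A = "\<lambda>n. multi_indices n :: (nat ^ 'd) set"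
  let ?d = "CARD('d)"
  have sub: "?A n \<subseteq> ?A (Suc n)" by (auto simp: multi_indices_def)
  have top: "mi_abs k = Suc n" if "k \<in> ?A (Suc n) - ?A n" for k
    using that by (auto simp: multi_indices_def)
  have "(\<Sum>k\<in>?A (Suc n). mi_abs k) = (\<Sum>k\<in>?A (Suc n) - ?A n. mi_abs k) + (\<Sum>k\<in>?A n. mi_abs k)"
    by (rule sum.subset_diff[OF sub]) (rule card_multi_indices)
  also have "(\<Sum>k\<in>?A (Suc n) - ?A n. mi_abs k) = card (?A (Suc n) - ?A n) * Suc n"
    by (simp add: top)
  also have "card (?A (Suc n) - ?A n) = num_mi ?d (Suc n) - num_mi ?d n"
    by (simp add: card_Diff_subset sub card_multi_indices)
  finally have *: "(\<Sum>k\<in>?A (Suc n). mi_abs k) =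
    (num_mi ?d (Suc n) - num_mi ?d n) * Suc n + mi_degree_sum ?d n" using Suc by simp
  obtain e where e: "?d = Suc e" by (metis card_gt_0_iff finite gr0_implies_Suc UNIV_not_empty)
  have "num_mi ?d (Suc n) - num_mi ?d n = (e + Suc n) choose Suc n"
    by (simp add: num_mi_def e)
  also have "\<dots> * Suc n = ?d * ((?d + n) choose ?d)"
    using Suc_times_binomial_add[of n e] binomial_symmetric[of n "?d + n"]
    by (simp add: e add.commute mult.commute del: binomial_Suc_Suc)
  finally have "(num_mi ?d (Suc n) - num_mi ?d n) * Suc n = ?d * ((?d + n) choose ?d)" .
  with * show ?case by (simp add: mi_degree_sum_def algebra_simps)
qed

text \<open>
  The source of the exponent in the theorem: \<open>1 / (n * num_mi d n)\<close> is \<open>d / (d + 1)\<close> times \<open>1 / mi_degree_sum d n\<close>.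
\<close>

lemma mi_degree_sum_num_mi: "(d + 1) * mi_degree_sum d n = d * n * num_mi d n"
proof (cases n)
  case (Suc m)
  show ?thesis
    using Suc_times_binomial_add[of d m] binomial_symmetric[of d "d + Suc m"]
    by (simp add: mi_degree_sum_def num_mi_def Suc algebra_simps del: binomial_Suc_Suc)
qed (simp add: mi_degree_sum_def)

lemma num_mi_le: "num_mi d n \<le> (n + 1) ^ d"
proof (induction d)
  case (Suc d)
  have "num_mi (Suc d) n = (\<Sum>m\<le>n. num_mi d m)"
    unfolding num_mi_def using sum_choose_lower[of d n] by simp
  also have "\<dots> \<le> (\<Sum>m\<le>n. (n + 1) ^ d)"
  proof (rule sum_mono)
    fix m assume "m \<in> {..n}"
    have "num_mi d m = (d + m) choose d"
      using binomial_symmetric[of d "d + m"] by (simp add: num_mi_def)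
    also have "\<dots> \<le> (d + n) choose d"
      using \<open>m \<in> {..n}\<close> by (intro binomial_right_mono) simp
    also have "\<dots> = num_mi d n"
      using binomial_symmetric[of d "d + n"] by (simp add: num_mi_def)
    finally show "num_mi d m \<le> (n + 1) ^ d" using Suc by simp
  qed
  finally show ?case by simp
qed (simp add: num_mi_def)

lemma num_mi_pos: "num_mi d n > 0"
  by (simp add: num_mi_def)

lemma finite_multi_indices [simp]: "finite (multi_indices n)"
  by (rule card_multi_indices)

lemma multi_indices_mono: "k \<in> multi_indices m \<Longrightarrow> m \<le> n \<Longrightarrow> k \<in> multi_indices n"
  by (simp add: multi_indices_def)

text \<open>
  On the curve \<open>z $ i = t ^ e i\<close> the monomial with exponent \<open>k\<close> is the power of \<open>t\<close> with exponent
  \<open>weight e k\<close>. A weight that is injective on the multi-indices in question therefore separates the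
  monomials, and it orders them compatibly with multiplication.
\<close>

definition weight :: "('d \<Rightarrow> nat) \<Rightarrow> nat ^ 'd \<Rightarrow> nat" where
  "weight e k = (\<Sum>i\<in>UNIV. e i * k $ i)"

lemma weight_add: "weight e (j + k) = weight e j + weight e k"
  by (simp add: weight_def sum.distrib distrib_left)

lemma radix_digits_unique:
  fixes f g :: "nat \<Rightarrow> nat"
  assumes "\<And>i. i < m \<Longrightarrow> f i < b" "\<And>i. i < m \<Longrightarrow> g i < b"
    and "(\<Sum>i<m. b ^ i * f i) = (\<Sum>i<m. b ^ i * g i)" and "i < m"
  shows "f i = g i"
  using assms
proof (induction m arbitrary: f g i)
  case (Suc m)
  have split: "(\<Sum>i<Suc m. b ^ i * h i) = h 0 + b * (\<Sum>i<m. b ^ i * h (Suc i))" for h :: "nat \<Rightarrow> nat"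
    by (simp add: sum.lessThan_Suc_shift sum_distrib_left mult.assoc del: sum.lessThan_Suc)
  have eq: "f 0 + b * (\<Sum>i<m. b ^ i * f (Suc i)) = g 0 + b * (\<Sum>i<m. b ^ i * g (Suc i))"
    using Suc.prems(3) by (simp only: split)
  have lt: "f 0 < b" "g 0 < b" using Suc.prems(1,2) by auto
  have 0: "f 0 = g 0"
    using arg_cong[OF eq, of "\<lambda>x. x mod b"] lt by simp
  have "(\<Sum>i<m. b ^ i * f (Suc i)) = (\<Sum>i<m. b ^ i * g (Suc i))"
    using eq 0 lt by simp
  then have "f (Suc i) = g (Suc i)" if "i < m" for i
    using Suc.IH[of "\<lambda>i. f (Suc i)" "\<lambda>i. g (Suc i)" i] Suc.prems(1,2) that by simp
  with 0 Suc.prems(4) show ?case by (cases i) auto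
qed simp

lemma mi_component_le: "k $ i \<le> mi_abs k"
  unfolding mi_abs_def by (rule member_le_sum) auto

text \<open>
  Kronecker substitution: with distinct powers of \<open>n + 1\<close> as \<open>e\<close>, the components of \<open>k\<close>, which are at
  most \<open>n\<close>, are the digits of \<open>weight e k\<close> in base \<open>n + 1\<close>.
\<close>

lemma ex_injective_weight:
  obtains e :: "'d::finite \<Rightarrow> nat" where "inj_on (weight e) (multi_indices n)"
proof -
  obtain s where s: "bij_betw s (UNIV :: 'd set) {..<CARD('d)}"
    using ex_bij_betw_finite_nat[of "UNIV :: 'd set"] by (auto simp: lessThan_atLeast0)
  define t where "t = inv_into UNIV s"
  have t: "bij_betw t {..<CARD('d)} UNIV" "\<And>i. t (s i) = i" "\<And>i. i < CARD('d) \<Longrightarrow> s (t i) = i"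
    using s by (auto simp: t_def bij_betw_inv_into bij_betw_inv_into_left bij_betw_inv_into_right)
  define e where "e i = (n + 1) ^ s i" for i
  have weight: "weight e k = (\<Sum>i<CARD('d). (n + 1) ^ i * k $ t i)" for k
    unfolding weight_def e_def sum.reindex_bij_betw[OF t(1), symmetric]
    by (rule sum.cong) (auto simp: t(3))
  have "inj_on (weight e) (multi_indices n)"
  proof (rule inj_onI)
    fix j k assume jk: "j \<in> multi_indices n" "k \<in> multi_indices n" "weight e j = weight e k"
    have lt: "j $ i < n + 1" "k $ i < n + 1" for i
      using jk(1,2) mi_component_le[of j i] mi_component_le[of k i] by (auto simp: multi_indices_def)
    have "j $ t i = k $ t i" if "i < CARD('d)" for i
      by (rule radix_digits_unique[of "CARD('d)" "\<lambda>i. j $ t i" "n + 1" "\<lambda>i. k $ t i"])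
         (use jk(3) lt that in \<open>simp_all only: weight\<close>)
    then have "j $ i = k $ i" for i
      using t(2)[of i] s by (metis UNIV_I bij_betwE lessThan_iff)
    then show "j = k" by (simp add: Finite_Cartesian_Product.vec_eq_iff)
  qed
  then show thesis by (rule that)
qed

lemma mpow_moment_curve: "mpow (\<chi> i. t ^ e i) k = t ^ weight e k"
  by (simp add: mpow_def weight_def power_sum power_mult)

lemma combination_of_monomials_nonzero:
  fixes a :: "nat ^ 'd \<Rightarrow> complex"
  assumes "k \<in> multi_indices n" "a k \<noteq> 0"
  shows "(\<lambda>z. \<Sum>k\<in>multi_indices n. a k * mpow z k) \<noteq> (\<lambda>z. 0)"
proof
  assume zero: "(\<lambda>z. \<Sum>k\<in>multi_indices n. a k * mpow z k) = (\<lambda>z. 0)"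
  obtain e :: "'d \<Rightarrow> nat" where e: "inj_on (weight e) (multi_indices n)"
    by (rule ex_injective_weight)
  define p where "p = (\<Sum>j\<in>multi_indices n. Polynomial.monom (a j) (weight e j))"
  have "poly p t = 0" for t
    using fun_cong[OF zero, of "\<chi> i. t ^ e i"]
    by (simp add: p_def poly_sum poly_monom mpow_moment_curve)
  then have "p = 0" using poly_all_0_iff_0 by blast
  then have "0 = Polynomial.coeff p (weight e k)" by simp
  also have "\<dots> = (\<Sum>j\<in>multi_indices n. if j = k then a j else 0)"
    unfolding p_def coeff_sum using assms(1) e
    by (intro sum.cong) (auto simp: inj_on_eq_iff)
  also have "\<dots> = a k" using assms(1) by simp
  finally show False using assms(2) by simp
qed

text \<open>
  The coefficients are restricted to \<open>R\<close> in order to treat integer and complex coefficients alike.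
\<close>

definition monomial_span :: "complex set \<Rightarrow> (nat ^ 'd) set \<Rightarrow> (complex ^ 'd \<Rightarrow> complex) set" where
  "monomial_span R S = {P. \<exists>c. (\<forall>k. c k \<in> R) \<and> P = (\<lambda>z. \<Sum>k\<in>S. c k * mpow z k)}"

lemma monomial_spanI: "(\<And>k. c k \<in> R) \<Longrightarrow> (\<And>z. P z = (\<Sum>k\<in>S. c k * mpow z k)) \<Longrightarrow> P \<in> monomial_span R S"
  unfolding monomial_span_def by blast

lemma monomial_span_mult:
  assumes "finite S" "finite T" "finite U" and U: "\<And>j k. j \<in> S \<Longrightarrow> k \<in> T \<Longrightarrow> j + k \<in> U"
    and R: "0 \<in> R" "\<And>x y. x \<in> R \<Longrightarrow> y \<in> R \<Longrightarrow> x + y \<in> R" "\<And>x y. x \<in> R \<Longrightarrow> y \<in> R \<Longrightarrow> x * y \<in> R"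
    and P: "P \<in> monomial_span R S" and Q: "Q \<in> monomial_span R T"
  shows "(\<lambda>z. P z * Q z) \<in> monomial_span R U"
proof -
  obtain a b where a: "\<And>k. a k \<in> R" "P = (\<lambda>z. \<Sum>k\<in>S. a k * mpow z k)"
    and b: "\<And>k. b k \<in> R" "Q = (\<lambda>z. \<Sum>k\<in>T. b k * mpow z k)"
    using P Q unfolding monomial_span_def by blast
  define c where "c k = (\<Sum>p | p \<in> S \<times> T \<and> fst p + snd p = k. a (fst p) * b (snd p))" for k
  have sum_R: "(\<Sum>x\<in>A. f x) \<in> R" if "\<And>x. x \<in> A \<Longrightarrow> f x \<in> R" for A and f :: "'x \<Rightarrow> complex"
    using that R by (induction A rule: infinite_finite_induct) auto
  show ?thesis
  proof (rule monomial_spanI)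
    show "c k \<in> R" for k
      unfolding c_def using a b R by (intro sum_R) auto
    fix z
    have "P z * Q z = (\<Sum>p\<in>S \<times> T. a (fst p) * b (snd p) * mpow z (fst p + snd p))"
      by (simp add: a b sum_product sum.cartesian_product mpow_add case_prod_unfold mult_ac)
    also have "\<dots> = (\<Sum>k\<in>U. \<Sum>p | p \<in> S \<times> T \<and> fst p + snd p = k. a (fst p) * b (snd p) * mpow z (fst p + snd p))"
      by (rule sum.group[symmetric]) (use assms in auto)
    also have "\<dots> = (\<Sum>k\<in>U. c k * mpow z k)"
      unfolding c_def sum_distrib_right by (intro sum.cong) auto
    finally show "P z * Q z = (\<Sum>k\<in>U. c k * mpow z k)" .
  qed
qed

lemma monomial_span_add:
  assumes "P \<in> monomial_span UNIV S" "Q \<in> monomial_span UNIV S"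
  shows "(\<lambda>z. P z + Q z) \<in> monomial_span UNIV S"
proof -
  obtain a b where "P = (\<lambda>z. \<Sum>k\<in>S. a k * mpow z k)" "Q = (\<lambda>z. \<Sum>k\<in>S. b k * mpow z k)"
    using assms unfolding monomial_span_def by blast
  then show ?thesis
    by (intro monomial_spanI[of "\<lambda>k. a k + b k"]) (auto simp: sum.distrib distrib_right)
qed

lemma monomial_span_mpow: "1 \<in> R \<Longrightarrow> (\<lambda>z. mpow z k) \<in> monomial_span R {k}"
  by (rule monomial_spanI[of "\<lambda>_. 1"]) auto

text \<open>
  The leading monomial is meant with respect to the order by \<open>w\<close>; the degree bound \<open>n\<close> applies to all
  monomials, so the lower ones may have larger degree than \<open>k\<close>.
\<close>

definition monic_wrt :: "(nat ^ 'd \<Rightarrow> nat) \<Rightarrow> nat \<Rightarrow> nat ^ 'd \<Rightarrow> (complex ^ 'd \<Rightarrow> complex) \<Rightarrow> bool" where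
  "monic_wrt w n k P \<longleftrightarrow> k \<in> multi_indices n \<and>
     (\<lambda>z. P z - mpow z k) \<in> monomial_span UNIV {j \<in> multi_indices n. w j < w k}"

lemma monic_mpow: "k \<in> multi_indices n \<Longrightarrow> monic_wrt w n k (\<lambda>z. mpow z k)"
  unfolding monic_wrt_def by (auto intro!: monomial_spanI[of "\<lambda>_. 0"])

lemma monomial_span_mono:
  assumes "P \<in> monomial_span R S" "S \<subseteq> T" "finite T" "0 \<in> R"
  shows "P \<in> monomial_span R T"
proof -
  obtain a where aR: "\<And>k. a k \<in> R" and a: "P = (\<lambda>z. \<Sum>k\<in>S. a k * mpow z k)"
    using assms unfolding monomial_span_def by blast
  have "P z = (\<Sum>k\<in>T. (if k \<in> S then a k else 0) * mpow z k)" for z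
    unfolding a using assms by (intro sum.mono_neutral_cong_left) auto
  then show ?thesis using aR assms(4) by (intro monomial_spanI[of "\<lambda>k. if k \<in> S then a k else 0"]) auto
qed

lemma monic_mono: "monic_wrt w m k P \<Longrightarrow> m \<le> n \<Longrightarrow> monic_wrt w n k P"
  unfolding monic_wrt_def
  by (auto intro: monomial_span_mono dest: multi_indices_mono)

lemma monic_mult:
  assumes w: "\<And>j k. w (j + k) = w j + w k"
    and P: "monic_wrt w m j P" and Q: "monic_wrt w n k Q"
  shows "monic_wrt w (m + n) (j + k) (\<lambda>z. P z * Q z)"
proof -
  let ?S = "{i \<in> multi_indices m. w i < w j}" and ?T = "{i \<in> multi_indices n. w i < w k}"
  let ?U = "{i \<in> multi_indices (m + n). w i < w (j + k)}"
  define A where "A z = P z - mpow z j" for z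
  define B where "B z = Q z - mpow z k" for z
  have A: "A \<in> monomial_span UNIV ?S" and B: "B \<in> monomial_span UNIV ?T"
    and jk: "j \<in> multi_indices m" "k \<in> multi_indices n"
    using P Q by (auto simp: monic_wrt_def A_def[abs_def] B_def[abs_def])
  have fin: "finite {i \<in> multi_indices m. Q i}" for m and Q :: "nat ^ 'd \<Rightarrow> bool"
    by simp
  have "(\<lambda>z. (mpow z j * B z + A z * mpow z k) + A z * B z) \<in> monomial_span UNIV ?U"
    by (intro monomial_span_add monomial_span_mult[OF _ fin fin _ _ _ _ monomial_span_mpow[OF UNIV_I] B]
          monomial_span_mult[OF fin _ fin _ _ _ _ A monomial_span_mpow[OF UNIV_I]] monomial_span_mult[OF fin fin fin _ _ _ _ A B])
       (use jk in \<open>auto simp: w multi_indices_def mi_abs_add\<close>)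
  moreover have "(\<lambda>z. (mpow z j * B z + A z * mpow z k) + A z * B z) =
      (\<lambda>z. P z * Q z - mpow z (j + k))"
    by (auto simp: A_def B_def mpow_add algebra_simps)
  moreover have "j + k \<in> multi_indices (m + n)"
    using jk by (auto simp: multi_indices_def mi_abs_add)
  ultimately show ?thesis by (simp add: monic_wrt_def)
qed

lemma monic_power:
  assumes w: "\<And>j k. w (j + k) = w j + w k" and P: "monic_wrt w m k P"
  shows "monic_wrt w (q * m) (\<chi> i. q * k $ i) (\<lambda>z. P z ^ q)"
proof (induction q)
  case 0
  have "(\<chi> i. 0 * k $ i) \<in> multi_indices 0" by (simp add: multi_indices_def mi_abs_def)
  from monic_mpow[OF this, of w] show ?case by (simp add: mpow_def)
next
  case (Suc q)
  have "k + (\<chi> i. q * k $ i) = (\<chi> i. Suc q * k $ i)" by (simp add: Finite_Cartesian_Product.vec_eq_iff)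
  with monic_mult[OF w P Suc] show ?case by simp
qed

section \<open>Vandermonde determinants\<close>

text \<open>
  Besides the full Vandermonde determinants, those for the initial segments of an enumeration of the
  multi-indices are used.
\<close>

definition vdm :: "nat \<Rightarrow> (nat \<Rightarrow> nat ^ 'd) \<Rightarrow> (nat \<Rightarrow> complex ^ 'd) \<Rightarrow> complex" where
  "vdm h e z = det_of h (\<lambda>i j. mpow (z i) (e j))"

lemma vandermonde_eq_vdm: "vandermonde n z = vdm (num_mi CARD('d) n) (mi_enum n) (z :: nat \<Rightarrow> complex ^ 'd)"
  by (simp add: vandermonde_def vdm_def det_of_def)

lemma vdm_cong: "(\<And>i. i < h \<Longrightarrow> z i = z' i) \<Longrightarrow> vdm h e z = vdm h e z'"
  unfolding vdm_def by (rule det_of_cong) simp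

lemma continuous_on_vdm:
  "continuous_on UNIV (vdm h (e :: nat \<Rightarrow> nat ^ 'd))"
proof -
  have "continuous_on UNIV (\<lambda>z :: nat \<Rightarrow> complex ^ 'd. mpow (z i) k)" for i k
    unfolding mpow_def
    by (intro continuous_on_prod continuous_on_power continuous_on_component
        continuous_on_product_coordinates)
  then show ?thesis
    unfolding vdm_def[abs_def] det_of_leibniz
    by (intro continuous_on_sum continuous_on_mult continuous_on_const continuous_on_prod)
qed

lemma vdm_attains_max:
  assumes "compact E" "E \<noteq> {}"
  shows "\<exists>\<zeta>. (\<forall>i. \<zeta> i \<in> E) \<and> (\<forall>z. (\<forall>i<h. z i \<in> E) \<longrightarrow> cmod (vdm h e z) \<le> cmod (vdm h e \<zeta>))"
proof -
  let ?Z = "PiE (UNIV :: nat set) (\<lambda>_. E)"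
  have "compact ?Z"
    using compactin_PiE[of "\<lambda>_ :: nat. euclidean" UNIV "\<lambda>_. E"] assms
    by (simp add: euclidean_product_topology)
  moreover have "?Z \<noteq> {}" using assms by (simp add: PiE_eq_empty_iff)
  moreover have "continuous_on ?Z (\<lambda>z. cmod (vdm h e z))"
    by (intro continuous_on_norm continuous_on_subset[OF continuous_on_vdm]) auto
  ultimately have "\<exists>\<zeta>\<in>?Z. \<forall>z\<in>?Z. cmod (vdm h e z) \<le> cmod (vdm h e \<zeta>)"
    by (rule continuous_attains_sup)
  then obtain \<zeta> where \<zeta>: "\<zeta> \<in> ?Z" "\<And>z. z \<in> ?Z \<Longrightarrow> cmod (vdm h e z) \<le> cmod (vdm h e \<zeta>)"
    by (elim bexE) simp
  show ?thesis
  proof (intro exI[of _ \<zeta>] conjI allI impI)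
    show "\<zeta> i \<in> E" for i using \<zeta>(1) by auto
    fix z assume "\<forall>i<h. z i \<in> E"
    then have "(\<lambda>i. if i < h then z i else \<zeta> i) \<in> ?Z" using \<zeta>(1) by auto
    from \<zeta>(2)[OF this] show "cmod (vdm h e z) \<le> cmod (vdm h e \<zeta>)"
      by (subst vdm_cong[of h z "\<lambda>i. if i < h then z i else \<zeta> i"]) auto
  qed
qed

definition max_vdm :: "nat \<Rightarrow> (nat \<Rightarrow> nat ^ 'd) \<Rightarrow> (complex ^ 'd) set \<Rightarrow> real" where
  "max_vdm h e E = (SUP z \<in> {z. \<forall>i. z i \<in> E}. cmod (vdm h e z))"

lemma max_vdm_attained:
  assumes "compact E" "E \<noteq> {}"
  obtains \<zeta> where "\<And>i. \<zeta> i \<in> E" "cmod (vdm h e \<zeta>) = max_vdm h e E"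
    "\<And>z. (\<And>i. i < h \<Longrightarrow> z i \<in> E) \<Longrightarrow> cmod (vdm h e z) \<le> max_vdm h e E"
proof -
  obtain \<zeta> where \<zeta>: "\<And>i. \<zeta> i \<in> E"
    "\<And>z. (\<forall>i<h. z i \<in> E) \<Longrightarrow> cmod (vdm h e z) \<le> cmod (vdm h e \<zeta>)"
    using vdm_attains_max[OF assms, of h e] by blast
  have "max_vdm h e E = cmod (vdm h e \<zeta>)"
    unfolding max_vdm_def using \<zeta> by (intro cSup_eq_maximum) auto
  then show thesis using that[of \<zeta>] \<zeta> by auto
qed

lemma max_vdm_0: 
  assumes "compact E" "E \<noteq> {}" shows "max_vdm 0 e E = 1"
  by (rule max_vdm_attained[OF assms, of 0 e]) (simp add: vdm_def)

lemma max_vdm_nonneg: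
  assumes "compact E" "E \<noteq> {}" shows "max_vdm h e E \<ge> 0"
  by (rule max_vdm_attained[OF assms, of h e]) (metis norm_ge_zero)

lemma vandermonde_fekete:
  fixes E :: "(complex ^ 'd) set"
  assumes "compact E" "E \<noteq> {}"
  shows "cmod (vandermonde n (SOME \<zeta>. fekete_points n E \<zeta>)) = max_vdm (num_mi CARD('d) n) (mi_enum n) E"
proof -
  let ?h = "num_mi CARD('d) n" and ?e = "mi_enum n :: nat \<Rightarrow> nat ^ 'd"
  define \<zeta> where "\<zeta> = (SOME \<zeta>. fekete_points n E \<zeta>)"
  obtain \<xi> where \<xi>: "\<And>i. \<xi> i \<in> E" "cmod (vdm ?h ?e \<xi>) = max_vdm ?h ?e E"
    "\<And>z. (\<And>i. i < ?h \<Longrightarrow> z i \<in> E) \<Longrightarrow> cmod (vdm ?h ?e z) \<le> max_vdm ?h ?e E"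
    by (rule max_vdm_attained[OF assms, of ?h ?e]) blast
  then have "fekete_points n E \<xi>" by (simp add: fekete_points_def vandermonde_eq_vdm)
  then have \<zeta>: "fekete_points n E \<zeta>" unfolding \<zeta>_def by (rule someI[of "fekete_points n E"])
  then have "cmod (vdm ?h ?e \<xi>) \<le> cmod (vdm ?h ?e \<zeta>)"
    using \<xi>(1) by (simp add: fekete_points_def vandermonde_eq_vdm)
  moreover have "cmod (vdm ?h ?e \<zeta>) \<le> max_vdm ?h ?e E"
    using \<zeta> by (intro \<xi>(3)) (simp add: fekete_points_def)
  ultimately show ?thesis
    using \<xi>(2) by (simp add: \<zeta>_def[symmetric] vandermonde_eq_vdm)
qed

lemma max_vdm_enumeration_independent:
  assumes e: "bij_betw e {..<h} D" and e': "bij_betw e' {..<h} D"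
  shows "max_vdm h e E = max_vdm h e' E"
proof -
  define p where "p i = (if i < h then inv_into {..<h} e (e' i) else i)" for i
  have "bij_betw (\<lambda>i. inv_into {..<h} e (e' i)) {..<h} {..<h}"
    using bij_betw_trans[OF e' bij_betw_inv_into[OF e]] by (simp add: o_def)
  then have "bij_betw p {..<h} {..<h}" by (rule bij_betw_cong[THEN iffD1, rotated]) (simp add: p_def)
  then have p: "p permutes {0..<h}"
    by (intro bij_imp_permutes) (auto simp: p_def lessThan_atLeast0)
  have "e (p i) = e' i" if "i < h" for i
    using that bij_betwE[OF e'] by (simp add: p_def bij_betw_inv_into_right[OF e])
  then have "vdm h e' z = det_of h (\<lambda>i j. mpow (z i) (e (p j)))" for z
    unfolding vdm_def by (intro det_of_cong) simp
  also have "\<dots>z = signof p * vdm h e z" for z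
    using det_of_permute_rows[OF p, of "\<lambda>j i. mpow (z i) (e j)"]
    by (simp add: vdm_def det_of_transpose[of h "\<lambda>j i. mpow (z i) (e j)", symmetric]
        det_of_transpose[of h "\<lambda>j i. mpow (z i) (e (p j))", symmetric])
  finally have "cmod (vdm h e' z) = cmod (vdm h e z)" for z
    by (simp add: norm_mult sign_def)
  then show ?thesis by (simp add: max_vdm_def)
qed

text \<open>
  When the multi-indices are enumerated with increasing weight, the change from monomials to
  polynomials with these leading monomials multiplies the Vandermonde matrix by a unitriangular one.
\<close>

lemma vdm_eq_det_monic:
  assumes e: "bij_betw e {..<h} (multi_indices N)" and w: "strict_mono_on {..<h} (\<lambda>i. w (e i))"
    and P: "\<And>j. j < h \<Longrightarrow> monic_wrt w N (e j) (P j)"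
  shows "det_of h (\<lambda>i j. P j (z i)) = vdm h e z"
proof -
  have "\<forall>j\<in>{..<h}. \<exists>c. \<forall>z. P j z - mpow z (e j) =
      (\<Sum>k\<in>{k \<in> multi_indices N. w k < w (e j)}. c k * mpow z k)"
  proof
    fix j assume "j \<in> {..<h}"
    then have "(\<lambda>z. P j z - mpow z (e j)) \<in> monomial_span UNIV {k \<in> multi_indices N. w k < w (e j)}"
      using P[of j] by (simp add: monic_wrt_def)
    then obtain c where "(\<lambda>z. P j z - mpow z (e j)) =
        (\<lambda>z. \<Sum>k\<in>{k \<in> multi_indices N. w k < w (e j)}. c k * mpow z k)"
      unfolding monomial_span_def by auto
    from fun_cong[OF this] show "\<exists>c. \<forall>z. P j z - mpow z (e j) =
        (\<Sum>k\<in>{k \<in> multi_indices N. w k < w (e j)}. c k * mpow z k)"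
      by (intro exI[of _ c] allI)
  qed
  from bchoice[OF this] obtain c where c: "\<And>j z. j < h \<Longrightarrow> P j z - mpow z (e j) =
      (\<Sum>k\<in>{k \<in> multi_indices N. w k < w (e j)}. c j k * mpow z k)"
    by auto
  define U where "U l j = (if l = j then 1 else if l < j then c j (e l) else 0)" for l j
  have "P j z = (\<Sum>l<h. mpow z (e l) * U l j)" if "j < h" for j z
  proof -
    have "P j z = mpow z (e j) + (\<Sum>k\<in>{k \<in> multi_indices N. w k < w (e j)}. c j k * mpow z k)"
      using c[OF that, of z] by (simp add: algebra_simps)
    also have "(\<Sum>k\<in>{k \<in> multi_indices N. w k < w (e j)}. c j k * mpow z k) =
        (\<Sum>k\<in>multi_indices N. if w k < w (e j) then c j k * mpow z k else 0)"
      by (rule sum.inter_filter) simp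
    also have "\<dots> = (\<Sum>l<h. if w (e l) < w (e j) then c j (e l) * mpow z (e l) else 0)"
      by (rule sum.reindex_bij_betw[OF e, symmetric])
    also have "\<dots> = (\<Sum>l<h. if l < j then c j (e l) * mpow z (e l) else 0)"
      using that strict_mono_on_less[OF w] by (intro sum.cong) auto
    also have "mpow z (e j) = (\<Sum>l<h. if l = j then mpow z (e l) else 0)"
      using that by simp
    also have "(\<Sum>l<h. if l = j then mpow z (e l) else 0) +
        (\<Sum>l<h. if l < j then c j (e l) * mpow z (e l) else 0) = (\<Sum>l<h. mpow z (e l) * U l j)"
      unfolding sum.distrib[symmetric] by (intro sum.cong) (auto simp: U_def)
    finally show ?thesis .
  qed
  then have "det_of h (\<lambda>i j. P j (z i)) = det_of h (\<lambda>i j. \<Sum>l<h. mpow (z i) (e l) * U l j)"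
    by (intro det_of_cong) simp
  also have "\<dots> = vdm h e z * det_of h U"
    by (simp add: det_of_mult vdm_def)
  also have "det_of h U = (\<Prod>i<h. U i i)"
    by (subst det_of_transpose[symmetric], rule det_of_lower_triangular) (auto simp: U_def)
  finally show ?thesis by (simp add: U_def)
qed

lemma det_of_le_fact_prod:
  fixes f :: "nat \<Rightarrow> nat \<Rightarrow> complex"
  assumes "\<And>i j. i < n \<Longrightarrow> j < n \<Longrightarrow> cmod (f i j) \<le> B j"
  shows "cmod (det_of n f) \<le> fact n * (\<Prod>j<n. B j)"
proof -
  have "cmod (signof p * (\<Prod>i=0..<n. f i (p i))) \<le> (\<Prod>j<n. B j)" if p: "p permutes {0..<n}" for p
  proof -
    have "cmod (signof p * (\<Prod>i=0..<n. f i (p i))) = (\<Prod>i=0..<n. cmod (f i (p i)))"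
      by (simp add: norm_mult sign_def prod_norm)
    also have "\<dots> \<le> (\<Prod>i=0..<n. B (p i))"
      using permutes_in_image[OF p] assms by (intro prod_mono) fastforce
    also have "\<dots> = (\<Prod>j<n. B j)"
      using prod.permute[OF p, of B] by (simp add: lessThan_atLeast0)
    finally show ?thesis .
  qed
  then have "cmod (det_of n f) \<le> (\<Sum>p | p permutes {0..<n}. \<Prod>j<n. B j)"
    unfolding det_of_leibniz by (intro order_trans[OF norm_sum] sum_mono) auto
  then show ?thesis by (simp add: card_permutations[of _ n])
qed

lemma max_vdm_le_prod_monic:
  assumes E: "compact E" "E \<noteq> {}"
    and e: "bij_betw e {..<h} (multi_indices N)" and w: "strict_mono_on {..<h} (\<lambda>i. w (e i))"
    and P: "\<And>k. k \<in> multi_indices N \<Longrightarrow> monic_wrt w N k (P k)"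
    and B: "\<And>k z. k \<in> multi_indices N \<Longrightarrow> z \<in> E \<Longrightarrow> cmod (P k z) \<le> B k"
  shows "max_vdm h e E \<le> fact h * (\<Prod>k\<in>multi_indices N. B k)"
proof -
  obtain \<zeta> where \<zeta>: "\<And>i. \<zeta> i \<in> E" "cmod (vdm h e \<zeta>) = max_vdm h e E"
    by (rule max_vdm_attained[OF E, of h e]) blast
  have ej: "e j \<in> multi_indices N" if "j < h" for j using that bij_betwE[OF e] by simp
  have "max_vdm h e E = cmod (det_of h (\<lambda>i j. P (e j) (\<zeta> i)))"
    using vdm_eq_det_monic[OF e w, of "\<lambda>j. P (e j)" \<zeta>] P ej \<zeta>(2) by simp
  also have "\<dots> \<le> fact h * (\<Prod>j<h. B (e j))"
    using B ej \<zeta>(1) by (intro det_of_le_fact_prod) auto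
  also have "(\<Prod>j<h. B (e j)) = (\<Prod>k\<in>multi_indices N. B k)"
    by (rule prod.reindex_bij_betw[OF e])
  finally show ?thesis .
qed

lemma det_of_Suc_last_row:
  "\<exists>c. \<forall>v. det_of (Suc m) (f(m := v)) = v m * det_of m f + (\<Sum>k<m. v k * c k)"
proof -
  obtain g where g: "\<And>v i. i < Suc m \<Longrightarrow> det_of (Suc m) (f(i := v)) = (\<Sum>k<Suc m. v k * g k i)"
    by (rule adjugate[of "Suc m" f]) blast
  let ?u = "\<lambda>k. if k = m then 1 else 0"
  have "g m m = det_of (Suc m) (f(m := ?u))"
  proof -
    have "(\<Sum>k<Suc m. ?u k * g k m) = (\<Sum>k<Suc m. if k = m then g k m else 0)"
      by (intro sum.cong) auto
    then show ?thesis using g[of m ?u] by simp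
  qed
  also have "\<dots> = det_of m f"
  proof -
    define A where "A = Matrix.mat (Suc m) (Suc m) (\<lambda>(i, j). (f(m := ?u)) i j)"
    have "Determinant.det A = (\<Sum>j<Suc m. A $$ (m, j) * cofactor A m j)"
      by (rule laplace_expansion_row) (auto simp: A_def)
    also have "\<dots> = (\<Sum>j<Suc m. if j = m then cofactor A m m else 0)"
    proof (rule sum.cong)
      fix j assume "j \<in> {..<Suc m}"
      then have "A $$ (m, j) = (if j = m then 1 else 0)" by (auto simp: A_def)
      then show "A $$ (m, j) * cofactor A m j = (if j = m then cofactor A m m else 0)" by simp
    qed simp
    also have "\<dots> = cofactor A m m" by simp
    also have "mat_delete A m m = Matrix.mat m m (\<lambda>(i, j). f i j)"
      unfolding mat_delete_def A_def by (rule eq_matI) auto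
    then have "cofactor A m m = det_of m f"
      by (simp add: cofactor_def det_of_def flip: power2_eq_square mult_2)
    finally show ?thesis by (simp add: det_of_def A_def)
  qed
  finally have "g m m = det_of m f" .
  then show ?thesis using g[of m] by (intro exI[of _ "\<lambda>k. g k m"]) (simp add: add.commute)
qed

text \<open>
  Expanded along its last row, the Vandermonde determinant of the first \<open>m + 1\<close> monomials is a
  polynomial in the last point, whose leading coefficient is the determinant of the first \<open>m\<close>.
\<close>

lemma monic_quotient_of_vdm:
  assumes e: "bij_betw e {..<h} (multi_indices M)" and w: "strict_mono_on {..<h} (\<lambda>i. w (e i))"
    and m: "m < h" and nz: "vdm m e \<zeta> \<noteq> 0"
  shows "monic_wrt w M (e m) (\<lambda>z. vdm (Suc m) e (\<zeta>(m := z)) / vdm m e \<zeta>)"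
proof -
  obtain c where c: "\<And>v. det_of (Suc m) ((\<lambda>i j. mpow (\<zeta> i) (e j))(m := v)) =
      v m * vdm m e \<zeta> + (\<Sum>k<m. v k * c k)"
    using det_of_Suc_last_row[of m "\<lambda>i j. mpow (\<zeta> i) (e j)"] unfolding vdm_def by blast
  have upd: "(\<lambda>i j. mpow ((\<zeta>(m := z)) i) (e j)) = (\<lambda>i j. mpow (\<zeta> i) (e j))(m := \<lambda>j. mpow z (e j))" for z
    by auto
  have vdm: "vdm (Suc m) e (\<zeta>(m := z)) = mpow z (e m) * vdm m e \<zeta> + (\<Sum>k<m. mpow z (e k) * c k)" for z
    using c[of "\<lambda>j. mpow z (e j)"] upd[of z] by (simp add: vdm_def)
  define a where "a k = c (inv_into {..<h} e k) / vdm m e \<zeta>" for k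
  have "vdm (Suc m) e (\<zeta>(m := z)) / vdm m e \<zeta> - mpow z (e m) =
      (\<Sum>k\<in>{k \<in> multi_indices M. w k < w (e m)}. a k * mpow z k)" for z
  proof -
    have "vdm (Suc m) e (\<zeta>(m := z)) / vdm m e \<zeta> - mpow z (e m) =
        (\<Sum>k<m. mpow z (e k) * c k) / vdm m e \<zeta>"
      using nz by (simp add: vdm field_simps)
    also have "\<dots> = (\<Sum>k<m. a (e k) * mpow z (e k))"
      unfolding sum_divide_distrib using m bij_betw_inv_into_left[OF e]
      by (intro sum.cong) (auto simp: a_def)
    also have "\<dots> = (\<Sum>l<h. if w (e l) < w (e m) then a (e l) * mpow z (e l) else 0)"
      using m strict_mono_on_less[OF w]
      by (intro sum.mono_neutral_cong_left) auto
    also have "\<dots> = (\<Sum>k\<in>multi_indices M. if w k < w (e m) then a k * mpow z k else 0)"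
      by (rule sum.reindex_bij_betw[OF e])
    also have "\<dots> = (\<Sum>k\<in>{k \<in> multi_indices M. w k < w (e m)}. a k * mpow z k)"
      by (rule sum.inter_filter[symmetric]) simp
    finally show ?thesis .
  qed
  moreover have "e m \<in> multi_indices M" using m bij_betwE[OF e] by simp
  ultimately show ?thesis
    unfolding monic_wrt_def by (intro conjI monomial_spanI[of a]) auto
qed

text \<open>
  At points that maximise the determinant of the first \<open>m\<close> monomials, the quotient in
  \<open>monic_quotient_of_vdm\<close> is bounded on \<open>E\<close> by the ratio of two successive maxima, and the product
  of these ratios telescopes. If some of the maxima vanish, the ratio just before the first of them
  is zero, so the product is zero whatever polynomials are taken afterwards.
\<close>

lemma ex_monic_with_prod_le_max_vdm:
  assumes E: "compact E" "E \<noteq> {}"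
    and e: "bij_betw e {..<h} (multi_indices M)" and w: "strict_mono_on {..<h} (\<lambda>i. w (e i))"
  shows "\<exists>P B. (\<forall>k\<in>multi_indices M. monic_wrt w M k (P k)) \<and>
    (\<forall>k\<in>multi_indices M. \<forall>z\<in>E. cmod (P k z) \<le> B k) \<and>
    (\<Prod>k\<in>multi_indices M. B k) \<le> max_vdm h e E"
proof -
  let ?V = "\<lambda>m. max_vdm m e E"
  have ej: "e j \<in> multi_indices M" if "j < h" for j using that bij_betwE[OF e] by simp
  have V0: "?V m \<ge> 0" for m by (rule max_vdm_nonneg[OF E])
  have "\<exists>P b. monic_wrt w M (e m) P \<and> (\<forall>z\<in>E. cmod (P z) \<le> b) \<and> b \<ge> 0 \<and> (?V m > 0 \<longrightarrow> b = ?V (Suc m) / ?V m)"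
    if m: "m < h" for m
  proof (cases "?V m = 0")
    case True
    have "continuous_on E (\<lambda>z. cmod (mpow z (e m)))"
      unfolding mpow_def by (intro continuous_intros continuous_on_component continuous_on_id)
    then obtain x where "x \<in> E" "\<forall>z\<in>E. cmod (mpow z (e m)) \<le> cmod (mpow x (e m))"
      using continuous_attains_sup[OF E] by blast
    then show ?thesis using True monic_mpow[OF ej[OF m], of w]
      by (intro exI[of _ "\<lambda>z. mpow z (e m)"] exI[of _ "cmod (mpow x (e m))"]) auto
  next
    case False
    obtain \<zeta> where \<zeta>: "\<And>i. \<zeta> i \<in> E" "cmod (vdm m e \<zeta>) = ?V m"
      by (rule max_vdm_attained[OF E, of m e]) blast
    have "cmod (vdm (Suc m) e (\<zeta>(m := z)) / vdm m e \<zeta>) \<le> ?V (Suc m) / ?V m" if "z \<in> E" for z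
    proof -
      have "cmod (vdm (Suc m) e (\<zeta>(m := z))) \<le> ?V (Suc m)"
        by (rule max_vdm_attained[OF E, of "Suc m" e]) (use \<zeta>(1) that in simp)
      then show ?thesis by (simp add: norm_divide \<zeta>(2) divide_right_mono V0)
    qed
    moreover have "vdm m e \<zeta> \<noteq> 0" using False \<zeta>(2) by auto
    ultimately show ?thesis using monic_quotient_of_vdm[OF e w m, of \<zeta>] V0
      by (intro exI[of _ "\<lambda>z. vdm (Suc m) e (\<zeta>(m := z)) / vdm m e \<zeta>"] exI[of _ "?V (Suc m) / ?V m"])
         simp
  qed
  then obtain P b where P: "\<And>m. m < h \<Longrightarrow> monic_wrt w M (e m) (P m)"
    and b: "\<And>m z. m < h \<Longrightarrow> z \<in> E \<Longrightarrow> cmod (P m z) \<le> b m" "\<And>m. m < h \<Longrightarrow> b m \<ge> 0"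
      "\<And>m. m < h \<Longrightarrow> ?V m > 0 \<Longrightarrow> b m = ?V (Suc m) / ?V m"
    by metis
  have prod: "(\<Prod>m<h. b m) \<le> ?V h"
  proof (cases "\<forall>m<h. ?V m > 0")
    case True
    have "(\<Prod>m<n. b m) = ?V n" if "n \<le> h" for n
      using that
    proof (induction n)
      case (Suc n)
      then have "?V n > 0" "b n = ?V (Suc n) / ?V n" using True b(3) by auto
      then show ?case using Suc by simp
    qed (simp add: max_vdm_0[OF E])
    then show ?thesis by simp
  next
    case False
    define n where "n = (LEAST m. \<not> ?V m > 0)"
    from False obtain m0 where m0: "m0 < h" "\<not> ?V m0 > 0" by blast
    have "\<not> ?V n > 0" unfolding n_def using m0(2) by (rule LeastI)
    moreover have "n < h"
      using Least_le[of "\<lambda>m. \<not> ?V m > 0" m0] m0 by (simp add: n_def)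
    moreover have "n \<noteq> 0"
    proof
      assume "n = 0"
      then show False using \<open>\<not> ?V n > 0\<close> max_vdm_0[OF E, of e] by simp
    qed
    then obtain m where m: "n = Suc m" using not0_implies_Suc by auto
    moreover have "?V m > 0"
    proof -
      have "m < (LEAST m. \<not> ?V m > 0)" using m by (simp add: n_def[symmetric])
      then show ?thesis using not_less_Least by blast
    qed
    ultimately have "b m = 0" "m < h" using b(3)[of m] V0[of n] by auto
    then have "(\<Prod>m<h. b m) = 0" by (intro prod_zero) auto
    then show ?thesis using V0[of h] by (simp only:)
  qed
  let ?i = "inv_into {..<h} e"
  have i: "?i k < h" "e (?i k) = k" if "k \<in> multi_indices M" for k
    using that bij_betwE[OF bij_betw_inv_into[OF e]] bij_betw_inv_into_right[OF e] by auto
  have prod_i: "(\<Prod>k\<in>multi_indices M. b (?i k)) = (\<Prod>m<h. b m)"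
    by (rule prod.reindex_bij_betw[OF bij_betw_inv_into[OF e]])
  show ?thesis
  proof (intro exI conjI ballI)
    show "monic_wrt w M k (P (?i k))" if "k \<in> multi_indices M" for k
      using P[OF i(1)[OF that]] i(2)[OF that] by simp
    show "cmod (P (?i k) z) \<le> b (?i k)" if "k \<in> multi_indices M" "z \<in> E" for k z
      using b(1)[OF i(1)[OF that(1)] that(2)] .
    show "(\<Prod>k\<in>multi_indices M. b (?i k)) \<le> ?V h"
      unfolding prod_i by (rule prod)
  qed
qed

lemma sorted_enumeration:
  fixes w :: "'a \<Rightarrow> nat"
  assumes "finite D" "inj_on w D"
  obtains e where "bij_betw e {..<card D} D" "strict_mono_on {..<card D} (\<lambda>i. w (e i))"
proof -
  have card: "card (w ` D) = card D" using assms(2) by (rule card_image)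
  obtain h where h: "bij_betw h {..<card D} (w ` D)" "strict_mono_on {..<card D} h"
    using ex_bij_betw_strict_mono_card[of "w ` D"] assms(1) card by auto
  have inv: "bij_betw (inv_into D w) (w ` D) D"
    using assms(2) by (intro bij_betw_inv_into inj_on_imp_bij_betw)
  show thesis
  proof (rule that)
    show "bij_betw (\<lambda>i. inv_into D w (h i)) {..<card D} D"
      using bij_betw_trans[OF h(1) inv] by (simp add: o_def)
    have "w (inv_into D w (h i)) = h i" if "i \<in> {..<card D}" for i
      using bij_betwE[OF h(1)] that by (intro f_inv_into_f) auto
    then show "strict_mono_on {..<card D} (\<lambda>i. w (inv_into D w (h i)))"
      using h(2) by (simp add: strict_mono_on_def)
  qed
qed

definition fekete_max :: "nat \<Rightarrow> (complex ^ 'd) set \<Rightarrow> real" where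
  "fekete_max n E = max_vdm (num_mi CARD('d) n) (mi_enum n) E"

lemma fekete_max_eq:
  fixes E :: "(complex ^ 'd) set"
  assumes "bij_betw e {..<num_mi CARD('d) n} (multi_indices n)"
  shows "fekete_max n E = max_vdm (num_mi CARD('d) n) e E"
  unfolding fekete_max_def by (rule max_vdm_enumeration_independent[OF bij_betw_mi_enum assms])

section \<open>The transfinite diameter as a limit\<close>

lemma cmod_mpow_le:
  assumes "\<And>i. cmod (z $ i) \<le> R"
  shows "cmod (mpow z k) \<le> R ^ mi_abs k"
proof -
  have "cmod (mpow z k) = (\<Prod>i\<in>UNIV. cmod (z $ i) ^ (k $ i))"
    by (simp add: mpow_def prod_norm[symmetric] norm_power)
  also have "\<dots> \<le> (\<Prod>i\<in>UNIV. R ^ (k $ i))"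
    using assms by (intro prod_mono) (auto intro: power_mono)
  finally show ?thesis by (simp add: mi_abs_def power_sum)
qed

lemma card_box: "card {r :: nat ^ 'd. \<forall>i. r $ i < q} = q ^ CARD('d)"
proof -
  have "bij_betw vec_nth {r :: nat ^ 'd. \<forall>i. r $ i < q} (PiE UNIV (\<lambda>_. {..<q}))"
    by (rule bij_betw_byWitness[where f' = vec_lambda]) auto
  from bij_betw_same_card[OF this] show ?thesis by (simp add: card_PiE)
qed

lemma mi_abs_le:
  fixes k :: "nat ^ 'd"
  assumes "\<And>i. k $ i \<le> b"
  shows "mi_abs k \<le> CARD('d) * b"
  using sum_bounded_above[of UNIV "\<lambda>i. k $ i" b] assms by (simp add: mi_abs_def)

text \<open>
  Every multi-index is \<open>q a + r\<close> with the components of \<open>r\<close> below \<open>q\<close>. If \<open>a\<close> has degree at most \<open>M\<close>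
  and \<open>P a\<close> is a good polynomial with leading exponent \<open>a\<close>, then \<open>P a z ^ q * mpow z r\<close> has leading exponent
  \<open>q a + r\<close>, and its degree is at most \<open>q M + d (q - 1) \<le> N\<close>. For the other multi-indices the monomial
  itself is used. Each \<open>a\<close> occurs with \<open>q ^ d\<close> remainders \<open>r\<close>, which explains the exponent
  \<open>q ^ (d + 1)\<close>, and \<open>s\<close> collects the degrees that are estimated by powers of \<open>R\<close>.
\<close>

lemma fekete_max_self_improvement:
  fixes E :: "(complex ^ 'd) set" and R :: real
  assumes E: "compact E" "E \<noteq> {}" and R: "\<And>z i. z \<in> E \<Longrightarrow> cmod (z $ i) \<le> R" "R > 0"
    and q: "q \<ge> 1" "q * (M + CARD('d)) \<le> N"
  shows "\<exists>s. s + q ^ (CARD('d) + 1) * mi_degree_sum CARD('d) M = mi_degree_sum CARD('d) N \<and>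
    fekete_max N E \<le> fact (num_mi CARD('d) N) * (R ^ s * fekete_max M E ^ (q ^ (CARD('d) + 1)))"
proof -
  let ?d = "CARD('d)"
  let ?A = "\<lambda>n. multi_indices n :: (nat ^ 'd) set"
  let ?Box = "{r :: nat ^ 'd. \<forall>i. r $ i < q}"
  have "M \<le> q * (M + ?d)" using q(1) by (metis le_add1 mult_le_mono nat_mult_1)
  then have MN: "M \<le> N" using q(2) by linarith
  obtain e0 :: "'d \<Rightarrow> nat" where "inj_on (weight e0) (?A N)" by (rule ex_injective_weight)
  define w where "w = weight e0"
  have w_add: "w (j + k) = w j + w k" for j k by (simp add: w_def weight_add)
  have inj: "inj_on w (?A n)" if "n \<le> N" for n
  proof -
    have "?A n \<subseteq> ?A N" using that by (auto intro: multi_indices_mono)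
    with \<open>inj_on (weight e0) (?A N)\<close> show ?thesis unfolding w_def by (rule inj_on_subset)
  qed
  have ex_e: "\<exists>e. bij_betw e {..<num_mi ?d n} (?A n) \<and> strict_mono_on {..<num_mi ?d n} (\<lambda>i. w (e i))" if n: "n \<le> N" for n
  proof -
    obtain e where "bij_betw e {..<card (?A n)} (?A n)" "strict_mono_on {..<card (?A n)} (\<lambda>i. w (e i))"
      by (rule sorted_enumeration[OF finite_multi_indices inj[OF n]])
    then show ?thesis by (intro exI[of _ e]) (simp add: card_multi_indices(2))
  qed
  obtain eM where eM: "bij_betw eM {..<num_mi ?d M} (?A M)" "strict_mono_on {..<num_mi ?d M} (\<lambda>i. w (eM i))"
    using ex_e[OF MN] by (elim exE conjE)
  obtain eN where eN: "bij_betw eN {..<num_mi ?d N} (?A N)" "strict_mono_on {..<num_mi ?d N} (\<lambda>i. w (eN i))"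
    using ex_e[OF order_refl] by (elim exE conjE)
  obtain P B where PB: "\<forall>k\<in>?A M. monic_wrt w M k (P k)" "\<forall>k\<in>?A M. \<forall>z\<in>E. cmod (P k z) \<le> B k"
    and "(\<Prod>k\<in>?A M. B k) \<le> max_vdm (num_mi ?d M) eM E"
    using ex_monic_with_prod_le_max_vdm[OF E eM] by (elim exE conjE) (rule that)
  then have prod_B: "(\<Prod>k\<in>?A M. B k) \<le> fekete_max M E"
    by (simp only: fekete_max_eq[OF eM(1)])
  have P: "monic_wrt w M k (P k)" if "k \<in> ?A M" for k using PB(1) that by (rule bspec)
  have B: "cmod (P k z) \<le> B k" if "k \<in> ?A M" "z \<in> E" for k z
    using PB(2) that by simp
  obtain z0 where "z0 \<in> E" using E(2) by blast
  have B0: "B k \<ge> 0" if "k \<in> ?A M" for k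
    using order_trans[OF norm_ge_zero B[OF that \<open>z0 \<in> E\<close>]] .
  define a where "a k = (\<chi> i. k $ i div q)" for k :: "nat ^ 'd"
  define r where "r k = (\<chi> i. k $ i mod q)" for k :: "nat ^ 'd"
  have split: "(\<chi> i. q * a k $ i) + r k = k" for k
    by (simp add: a_def r_def Finite_Cartesian_Product.vec_eq_iff)
  have abs_split: "mi_abs k = q * mi_abs (a k) + mi_abs (r k)" for k
  proof -
    have "mi_abs ((\<chi> i. q * a k $ i) + r k) = q * mi_abs (a k) + mi_abs (r k)"
      by (simp only: mi_abs_add) (simp add: mi_abs_def sum_distrib_left)
    then show ?thesis by (simp only: split)
  qed
  have r_box: "r k \<in> ?Box" for k using q(1) by (simp add: r_def)
  have box: "mi_abs k \<le> ?d * (q - 1)" if "k \<in> ?Box" for k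
  proof (rule mi_abs_le)
    show "k $ i \<le> q - 1" for i
    proof -
      have "k $ i < q" using that by simp
      then show ?thesis by linarith
    qed
  qed
  have qMd: "q * M + ?d * (q - 1) \<le> N"
  proof -
    have "q * M + ?d * (q - 1) \<le> q * M + ?d * q" by simp
    then show ?thesis using q(2) by (simp add: algebra_simps)
  qed
  define X where "X = {k \<in> ?A N. a k \<in> ?A M}"
  have X: "X \<subseteq> ?A N" "finite X" by (auto simp: X_def)
  define Q where "Q k = (if k \<in> X then (\<lambda>z. P (a k) z ^ q * mpow z (r k)) else (\<lambda>z. mpow z k))" for k
  define s where "s k = (if k \<in> X then mi_abs (r k) else mi_abs k)" for k
  define b where "b k = (if k \<in> X then B (a k) ^ q else 1) * R ^ s k" for k
  have Q: "monic_wrt w N k (Q k)" if "k \<in> ?A N" for k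
  proof (cases "k \<in> X")
    case True
    then have "a k \<in> ?A M" by (simp add: X_def)
    have "r k \<in> ?A (?d * (q - 1))"
      using box[OF r_box] by (simp add: multi_indices_def)
    from monic_mult[OF w_add monic_power[OF w_add P[OF \<open>a k \<in> ?A M\<close>], where q = q] monic_mpow[OF this]]
    have "monic_wrt w (q * M + ?d * (q - 1)) k (\<lambda>z. P (a k) z ^ q * mpow z (r k))"
      by (simp only: split)
    from monic_mono[OF this qMd] show ?thesis using True by (simp add: Q_def)
  next
    case False
    then show ?thesis using monic_mpow[OF that, of w] by (simp add: Q_def)
  qed
  have b: "cmod (Q k z) \<le> b k" if "k \<in> ?A N" "z \<in> E" for k z
  proof (cases "k \<in> X")
    case True
    then have "a k \<in> ?A M" by (simp add: X_def)
    then have "cmod (P (a k) z ^ q * mpow z (r k)) \<le> B (a k) ^ q * R ^ mi_abs (r k)"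
      unfolding norm_mult norm_power using R that(2) B B0 
      by (intro mult_mono power_mono cmod_mpow_le) auto
    then show ?thesis using True by (simp add: Q_def b_def s_def)
  next
    case False
    then show ?thesis using cmod_mpow_le[of z R k] R(1)[OF that(2)] by (simp add: Q_def b_def s_def)
  qed
  have bij: "bij_betw (\<lambda>(c, t). (\<chi> i. q * c $ i) + t) (?A M \<times> ?Box) X"
  proof -
    have at: "a ((\<chi> i. q * c $ i) + t) = c \<and> r ((\<chi> i. q * c $ i) + t) = t" if "t \<in> ?Box" for c t
      using that q(1) by (simp add: a_def r_def Finite_Cartesian_Product.vec_eq_iff)
    have "(\<chi> i. q * c $ i) + t \<in> X" if ct: "c \<in> ?A M" "t \<in> ?Box" for c t
    proof -
      have "mi_abs ((\<chi> i. q * c $ i) + t) = q * mi_abs c + mi_abs t"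
        using abs_split[of "(\<chi> i. q * c $ i) + t"] at[OF ct(2)] by simp
      also have "\<dots> \<le> q * M + ?d * (q - 1)"
        using box[OF ct(2)] ct(1) by (intro add_mono mult_left_mono) (auto simp: multi_indices_def)
      finally show ?thesis using qMd ct(1) at[OF ct(2)] by (simp add: X_def multi_indices_def[of N])
    qed
    then show ?thesis
      by (intro bij_betw_byWitness[where f' = "\<lambda>k. (a k, r k)"])
         (use at split r_box in \<open>auto simp: X_def\<close>)
  qed
  have aX: "a ((\<lambda>(c, t). (\<chi> i. q * c $ i) + t) p) = fst p" if "p \<in> ?A M \<times> ?Box" for p
    using that q(1) by (auto simp: a_def Finite_Cartesian_Product.vec_eq_iff)
  have sum_X: "(\<Sum>k\<in>X. q * mi_abs (a k)) = q ^ (?d + 1) * mi_degree_sum ?d M"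
  proof -
    have "(\<Sum>k\<in>X. q * mi_abs (a k)) = (\<Sum>p\<in>?A M \<times> ?Box. q * mi_abs (fst p))"
      unfolding sum.reindex_bij_betw[OF bij, symmetric] by (rule sum.cong[OF refl]) (simp only: aX)
    also have "\<dots> = (\<Sum>c\<in>?A M. \<Sum>t\<in>?Box. q * mi_abs c)"
      by (simp only: sum.cartesian_product case_prod_unfold)
    also have "\<dots> = q ^ (?d + 1) * (\<Sum>c\<in>?A M. mi_abs c)"
      unfolding sum_distrib_left by (intro sum.cong) (simp_all add: card_box mult_ac)
    finally show ?thesis by (simp add: sum_mi_abs)
  qed
  have prod_X: "(\<Prod>k\<in>X. B (a k) ^ q) = (\<Prod>c\<in>?A M. B c) ^ (q ^ (?d + 1))"
  proof -
    have "(\<Prod>k\<in>X. B (a k) ^ q) = (\<Prod>p\<in>?A M \<times> ?Box. B (fst p) ^ q)"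
      unfolding prod.reindex_bij_betw[OF bij, symmetric] by (rule prod.cong[OF refl]) (simp only: aX)
    also have "\<dots> = (\<Prod>c\<in>?A M. \<Prod>t\<in>?Box. B c ^ q)"
      by (simp only: prod.cartesian_product case_prod_unfold)
    also have "\<dots> = (\<Prod>c\<in>?A M. B c ^ (q ^ (?d + 1)))"
      by (simp add: card_box power_mult[symmetric])
    finally show ?thesis by (simp add: prod_power_distrib)
  qed
  show ?thesis
  proof (intro exI conjI)
    have "mi_abs k = s k + (if k \<in> X then q * mi_abs (a k) else 0)" for k
      using abs_split[of k] by (simp add: s_def)
    then have "(\<Sum>k\<in>?A N. mi_abs k) = (\<Sum>k\<in>?A N. s k + (if k \<in> X then q * mi_abs (a k) else 0))"
      by (rule sum.cong[OF refl])
    also have "\<dots> = (\<Sum>k\<in>?A N. s k) + (\<Sum>k\<in>X. q * mi_abs (a k))"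
      unfolding sum.distrib using X
      by (simp add: sum.inter_restrict[symmetric] Int_absorb1)
    finally show "(\<Sum>k\<in>?A N. s k) + q ^ (?d + 1) * mi_degree_sum ?d M = mi_degree_sum ?d N"
      by (simp only: sum_mi_abs sum_X)
    have "fekete_max N E \<le> fact (num_mi ?d N) * (\<Prod>k\<in>?A N. b k)"
      unfolding fekete_max_eq[OF eN(1)]
      by (rule max_vdm_le_prod_monic[OF E eN, where P = Q]) (auto intro: Q b)
    also have "(\<Prod>k\<in>?A N. b k) = (\<Prod>k\<in>X. B (a k) ^ q) * R ^ (\<Sum>k\<in>?A N. s k)"
      unfolding b_def prod.distrib power_sum using X
      by (simp add: prod.inter_restrict[symmetric] Int_absorb1)
    also have "(\<Prod>k\<in>X. B (a k) ^ q) \<le> fekete_max M E ^ (q ^ (?d + 1))"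
      unfolding prod_X using B0 prod_B by (intro power_mono prod_nonneg) auto
    finally show "fekete_max N E \<le> fact (num_mi ?d N) *
        (R ^ (\<Sum>k\<in>?A N. s k) * fekete_max M E ^ (q ^ (?d + 1)))"
      using R(2) by (simp add: mult.commute mult_left_mono mult_right_mono)
  qed
qed

text \<open>
  Let \<open>u\<close> and \<open>v\<close> be limits of two subsequences. Letting \<open>N\<close> tend to infinity along the second one
  gives \<open>v \<le> x m powr \<eta> m\<close> for every \<open>m\<close>, and letting \<open>m\<close> tend to infinity along the first one gives
  \<open>v \<le> u\<close>. So all subsequential limits agree. If \<open>x m = 0\<close> for some \<open>m \<ge> 1\<close>, then all but finitely many
  terms vanish; this case is separate, because \<open>powr\<close> is continuous for positive bases only.
\<close>

lemma convergent_if_dominated_by_each_term: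
  fixes x :: "nat \<Rightarrow> real"
  assumes bd: "\<And>n. x n \<in> {0..B}"
    and dom: "\<And>m. m \<ge> 1 \<Longrightarrow> \<forall>\<^sub>F N in sequentially. x N \<le> c N * x m powr \<theta> m N"
    and c: "c \<longlonglongrightarrow> 1"
    and \<theta>: "\<And>m. m \<ge> 1 \<Longrightarrow> \<theta> m \<longlonglongrightarrow> \<eta> m" and \<eta>: "\<eta> \<longlonglongrightarrow> 1"
  shows "convergent x"
proof (cases "\<exists>m\<ge>1. x m = 0")
  case True
  then obtain m where m: "m \<ge> 1" "x m = 0" by blast
  have "x \<longlonglongrightarrow> 0"
  proof (rule tendsto_sandwich[OF _ _ tendsto_const tendsto_const])
    show "\<forall>\<^sub>F N in sequentially. x N \<le> 0"
      using dom[OF m(1)] m(2) by simp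
  qed (use bd in auto)
  then show ?thesis by (rule convergentI)
next
  case False
  then have pos: "x m > 0" if "m \<ge> 1" for m
    using bd[of m] that by (metis atLeastAtMost_iff order_le_less)
  have limits_le: "v \<le> u"
    if r: "strict_mono r" "(x \<circ> r) \<longlonglongrightarrow> u" and s: "strict_mono s" "(x \<circ> s) \<longlonglongrightarrow> v" for r s u v
  proof (rule ccontr)
    assume "\<not> v \<le> u"
    moreover have "u \<ge> 0"
      by (rule LIMSEQ_le_const[OF r(2)]) (use bd in auto)
    ultimately have v: "v > 0" "u < v" by auto
    have v_le: "v \<le> x m powr \<eta> m" if m: "m \<ge> 1" for m
    proof (rule LIMSEQ_le[OF s(2)])
      have "(\<lambda>k. c (s k) * x m powr \<theta> m (s k)) \<longlonglongrightarrow> 1 * x m powr \<eta> m"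
        using LIMSEQ_subseq_LIMSEQ[OF c s(1)] LIMSEQ_subseq_LIMSEQ[OF \<theta>[OF m] s(1)] pos[OF m]
        by (intro tendsto_mult tendsto_powr tendsto_const) (auto simp: o_def)
      then show "(\<lambda>k. c (s k) * x m powr \<theta> m (s k)) \<longlonglongrightarrow> x m powr \<eta> m" by simp
      have "\<forall>\<^sub>F k in sequentially. x (s k) \<le> c (s k) * x m powr \<theta> m (s k)"
        using dom[OF m] filterlim_subseq[OF s(1)] by (rule eventually_compose_filterlim)
      then show "\<exists>K. \<forall>k\<ge>K. (x \<circ> s) k \<le> c (s k) * x m powr \<theta> m (s k)"
        by (simp add: eventually_sequentially)
    qed
    have \<eta>r: "(\<lambda>k. \<eta> (r k)) \<longlonglongrightarrow> 1"
      using LIMSEQ_subseq_LIMSEQ[OF \<eta> r(1)] by (simp add: o_def)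
    have "(\<lambda>k. v powr (1 / \<eta> (r k))) \<longlonglongrightarrow> v powr (1 / 1)"
      using v by (intro tendsto_powr tendsto_divide \<eta>r tendsto_const) auto
    then have lim: "(\<lambda>k. v powr (1 / \<eta> (r k))) \<longlonglongrightarrow> v" using v by simp
    have "\<forall>\<^sub>F k in sequentially. \<eta> (r k) > 0"
      using \<eta>r by (rule order_tendstoD) simp
    moreover have "\<forall>\<^sub>F k in sequentially. r k \<ge> 1"
      using filterlim_subseq[OF r(1)] by (simp add: filterlim_at_top)
    ultimately have "\<forall>\<^sub>F k in sequentially. v powr (1 / \<eta> (r k)) \<le> (x \<circ> r) k"
    proof eventually_elim
      case (elim k)
      have "v powr (1 / \<eta> (r k)) \<le> (x (r k) powr \<eta> (r k)) powr (1 / \<eta> (r k))"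
        using v v_le[OF elim(2)] elim by (intro powr_mono2) auto
      then show ?case using elim pos[of "r k"] by (simp add: powr_powr)
    qed
    then have "v \<le> u"
      using LIMSEQ_le[OF lim r(2)] by (auto simp: eventually_sequentially)
    with v show False by simp
  qed
  have subseq: "\<exists>l r. strict_mono (r :: nat \<Rightarrow> nat) \<and> (x \<circ> t \<circ> r) \<longlonglongrightarrow> l" for t
    using compact_Icc[of 0 B] bd unfolding compact_eq_seq_compact_metric seq_compact_def
    by (metis comp_apply)
  obtain u r where r: "strict_mono r" "(x \<circ> r) \<longlonglongrightarrow> u" using subseq[of id] by auto
  have "x \<longlonglongrightarrow> u"
  proof (rule ccontr)
    assume "\<not> x \<longlonglongrightarrow> u"
    then obtain e where e: "e > 0" "\<not> (\<forall>\<^sub>F n in sequentially. dist (x n) u < e)"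
      unfolding tendsto_iff by blast
    then have "\<exists>\<^sub>F n in sequentially. dist (x n) u \<ge> e"
      by (simp add: frequently_def not_le)
    then have "infinite {n. dist (x n) u \<ge> e}"
      by (simp add: frequently_cofinite flip: cofinite_eq_sequentially)
    then obtain t :: "nat \<Rightarrow> nat" where t: "strict_mono t" "\<And>n. t n \<in> {n. dist (x n) u \<ge> e}"
      using infinite_enumerate by blast
    obtain v q where q: "strict_mono q" "(x \<circ> t \<circ> q) \<longlonglongrightarrow> v" using subseq[of t] by blast
    have tq: "strict_mono (t \<circ> q)" "(x \<circ> (t \<circ> q)) \<longlonglongrightarrow> v"
      using t(1) q by (auto intro: strict_mono_o simp: o_assoc)
    then have "u = v"
      using limits_le[OF r tq] limits_le[OF tq r] by simp
    moreover have "dist v u \<ge> e"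
      by (rule LIMSEQ_le_const[OF tendsto_dist[OF q(2) tendsto_const]]) (use t(2) in auto)
    ultimately show False using e(1) by simp
  qed
  then show ?thesis by (rule convergentI)
qed

lemma num_mi_root_tendsto_1: "(\<lambda>n. root n (real (num_mi d n))) \<longlonglongrightarrow> 1"
proof (rule tendsto_sandwich[where f = "\<lambda>_. 1" and h = "\<lambda>n. root n (real ((n + 1) ^ d))"])
  have "(\<lambda>n. real (n + 1) powr (real d / real n)) \<longlonglongrightarrow> 1"
    by real_asymp
  moreover have "\<forall>\<^sub>F n in sequentially. real (n + 1) powr (real d / real n) = root n (real ((n + 1) ^ d))"
    using eventually_gt_at_top[of 0]
    by eventually_elim (simp add: root_powr_inverse powr_realpow[symmetric] powr_powr flip: of_nat_Suc)
  ultimately show "(\<lambda>n. root n (real ((n + 1) ^ d))) \<longlonglongrightarrow> 1"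
    by (blast intro: Lim_transform_eventually)
  show "\<forall>\<^sub>F n in sequentially. root n (real (num_mi d n)) \<le> root n (real ((n + 1) ^ d))"
    using eventually_gt_at_top[of 0]
    by eventually_elim (intro real_root_le_mono of_nat_mono num_mi_le)
  show "\<forall>\<^sub>F n in sequentially. 1 \<le> root n (real (num_mi d n))"
    using eventually_gt_at_top[of 0]
    by eventually_elim (use num_mi_pos[of d] in \<open>simp add: Suc_leI\<close>)
qed simp

lemma mi_degree_sum_asymptotics:
  "(\<lambda>n. real (mi_degree_sum d n) / real n ^ (d + 1)) \<longlonglongrightarrow> real d / fact (d + 1)"
proof -
  have "(\<lambda>n. (real (d + n) - real i) / real n) \<longlonglongrightarrow> 1" for i
    by real_asymp
  then have "(\<lambda>n. \<Prod>i=0..<d + 1. (real (d + n) - real i) / real n) \<longlonglongrightarrow> (\<Prod>i=0..<d + 1. 1)"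
    by (intro tendsto_prod)
  then have "(\<lambda>n. real d * ((\<Prod>i=0..<d + 1. (real (d + n) - real i) / real n) / fact (d + 1)))
      \<longlonglongrightarrow> real d * (1 / fact (d + 1))"
    by (intro tendsto_mult tendsto_divide tendsto_const) auto
  moreover have "real d * ((\<Prod>i=0..<d + 1. (real (d + n) - real i) / real n) / fact (d + 1)) =
      real (mi_degree_sum d n) / real n ^ (d + 1)" for n
  proof -
    have "real ((d + n) choose (d + 1)) = (\<Prod>i=0..<d + 1. real (d + n) - real i) / fact (d + 1)"
      unfolding binomial_gbinomial by (rule gbinomial_prod_rev)
    then show ?thesis
      unfolding mi_degree_sum_def prod_dividef by (simp del: prod.op_ivl_Suc power_Suc)
  qed
  ultimately show ?thesis by simp
qed

lemma real_mi_degree_sum: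
  "(real d + 1) * real (mi_degree_sum d n) = real d * real n * real (num_mi d n)"
  using arg_cong[OF mi_degree_sum_num_mi[of d n], of real] by (simp add: distrib_right)

lemma mi_degree_sum_pos: "d \<ge> 1 \<Longrightarrow> n \<ge> 1 \<Longrightarrow> mi_degree_sum d n > 0"
  by (simp add: mi_degree_sum_def)

lemma root_mi_degree_sum:
  assumes "d \<ge> 1" "n \<ge> 1" "x \<ge> 0"
  shows "root n (root (num_mi d n) x) = root (mi_degree_sum d n) x powr (real d / (real d + 1))"
proof (cases "x = 0")
  case False
  then have x: "x > 0" using assms by simp
  have l: "mi_degree_sum d n > 0" using assms by (rule_tac mi_degree_sum_pos)
  have "1 / real (num_mi d n) * (1 / real n) = 1 / real (mi_degree_sum d n) * (real d / (real d + 1))"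
    using assms l num_mi_pos[of d n] real_mi_degree_sum[of d n] by (simp add: field_simps)
  then show ?thesis
    using assms x l num_mi_pos[of d n] by (simp add: root_powr_inverse powr_powr inverse_eq_divide)
qed (use assms in simp)

lemma root_fact_num_mi_tendsto_1:
  assumes d: "d \<ge> 1"
  shows "(\<lambda>n. root (mi_degree_sum d n) (fact (num_mi d n))) \<longlonglongrightarrow> 1"
proof (rule tendsto_sandwich[where f = "\<lambda>_. 1" and h = "\<lambda>n. root n (num_mi d n) powr ((real d + 1) / real d)"])
  show "\<forall>\<^sub>F n in sequentially. 1 \<le> root (mi_degree_sum d n) (fact (num_mi d n))"
    using eventually_ge_at_top[of 1]
    by eventually_elim (use mi_degree_sum_pos[OF d] in simp)
  show "\<forall>\<^sub>F n in sequentially. root (mi_degree_sum d n) (fact (num_mi d n)) \<le>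
      root n (num_mi d n) powr ((real d + 1) / real d)"
    using eventually_ge_at_top[of 1]
  proof eventually_elim
    case (elim n)
    let ?h = "num_mi d n" and ?l = "mi_degree_sum d n"
    have l: "?l > 0" using d elim by (rule mi_degree_sum_pos)
    have h: "?h > 0" by (rule num_mi_pos)
    have "root ?l (fact ?h) \<le> root ?l (real ?h ^ ?h)"
      using l fact_le_power[of ?h] by (intro real_root_le_mono) auto
    also have "\<dots> = real ?h powr (real ?h / real ?l)"
      using l h by (simp add: root_powr_inverse powr_realpow[symmetric] powr_powr divide_inverse)
    also have "real ?h / real ?l = 1 / real n * ((real d + 1) / real d)"
      using d elim l real_mi_degree_sum[of d n] by (simp add: field_simps)
    also have "real ?h powr (1 / real n * ((real d + 1) / real d)) = root n ?h powr ((real d + 1) / real d)"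
      using elim h by (simp add: root_powr_inverse powr_powr inverse_eq_divide)
    finally show ?case .
  qed
  have "(\<lambda>n. root n (num_mi d n) powr ((real d + 1) / real d)) \<longlonglongrightarrow> 1 powr ((real d + 1) / real d)"
    by (intro tendsto_powr num_mi_root_tendsto_1 tendsto_const) simp
  then show "(\<lambda>n. root n (num_mi d n) powr ((real d + 1) / real d)) \<longlonglongrightarrow> 1" by simp
qed simp

lemma div_asymptotics:
  assumes "k > 0"
  shows "(\<lambda>n. real (n div k) / real n) \<longlonglongrightarrow> 1 / real k"
proof (rule tendsto_sandwich[where f = "\<lambda>n. 1 / real k - 1 / real n" and h = "\<lambda>_. 1 / real k"])
  show "\<forall>\<^sub>F n in sequentially. 1 / real k - 1 / real n \<le> real (n div k) / real n"
    using eventually_gt_at_top[of 0]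
  proof eventually_elim
    case (elim n)
    have "real n = real k * real (n div k) + real (n mod k)"
      by (metis mult_div_mod_eq of_nat_add of_nat_mult)
    moreover have "real (n mod k) \<le> real k" using assms by (simp add: less_imp_le)
    ultimately have "real n \<le> (real (n div k) + 1) * real k" by (simp add: algebra_simps)
    then have "real n / real k \<le> real (n div k) + 1" using assms by (simp add: pos_divide_le_eq)
    then have "real n / real k - 1 \<le> real (n div k)" by linarith
    then have "(real n / real k - 1) / real n \<le> real (n div k) / real n" by (rule divide_right_mono) simp
    then show ?case using elim by (simp add: diff_divide_distrib)
  qed
  show "\<forall>\<^sub>F n in sequentially. real (n div k) / real n \<le> 1 / real k"
    using eventually_gt_at_top[of 0]
  proof eventually_elim
    case (elim n)
    have "real (n div k) * real k \<le> real n"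
      unfolding of_nat_mult[symmetric] of_nat_le_iff by simp
    then show ?case using assms elim by (simp add: field_simps)
  qed
  show "(\<lambda>n. 1 / real k - 1 / real n) \<longlonglongrightarrow> 1 / real k" by real_asymp
qed simp

lemma root_power_eq_powr:
  assumes "n > 0" "m > 0" "(x :: real) \<ge> 0"
  shows "root n (x ^ m) = x powr (real m / real n)"
  using assms
  by (cases "x = 0") (auto simp: root_powr_inverse powr_realpow[symmetric] powr_powr divide_inverse)

lemma fekete_max_nonneg: "compact E \<Longrightarrow> E \<noteq> {} \<Longrightarrow> fekete_max n E \<ge> 0"
  unfolding fekete_max_def by (rule max_vdm_nonneg)

lemma bounded_coordinates:
  fixes E :: "(complex ^ 'd) set"
  assumes "compact E"
  obtains R :: real where "R \<ge> 1" "\<And>z i. z \<in> E \<Longrightarrow> cmod (z $ i) \<le> R"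
proof -
  obtain b where b: "\<forall>z\<in>E. norm z \<le> b"
    using compact_imp_bounded[OF assms] by (auto simp: bounded_iff)
  show thesis
  proof (rule that[of "\<bar>b\<bar> + 1"])
    fix z i assume "z \<in> E"
    then have "norm z \<le> \<bar>b\<bar> + 1" using b by force
    then show "cmod (z $ i) \<le> \<bar>b\<bar> + 1"
      using Finite_Cartesian_Product.norm_nth_le[of z i] by linarith
  qed simp
qed

lemma fekete_max_le:
  fixes E :: "(complex ^ 'd) set"
  assumes E: "compact E" "E \<noteq> {}" and R: "\<And>z i. z \<in> E \<Longrightarrow> cmod (z $ i) \<le> R"
  shows "fekete_max n E \<le> fact (num_mi CARD('d) n) * R ^ mi_degree_sum CARD('d) n"
proof -
  let ?h = "num_mi CARD('d) n" and ?e = "mi_enum n :: nat \<Rightarrow> nat ^ 'd"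
  obtain \<zeta> where \<zeta>: "\<And>i. \<zeta> i \<in> E" "cmod (vdm ?h ?e \<zeta>) = fekete_max n E"
    unfolding fekete_max_def by (rule max_vdm_attained[OF E, of ?h ?e]) blast
  have "cmod (vdm ?h ?e \<zeta>) \<le> fact ?h * (\<Prod>j<?h. R ^ mi_abs (?e j))"
    unfolding vdm_def using \<zeta>(1) R by (intro det_of_le_fact_prod cmod_mpow_le) auto
  also have "(\<Prod>j<?h. R ^ mi_abs (?e j)) = R ^ (\<Sum>j<?h. mi_abs (?e j))"
    by (simp add: power_sum)
  also have "(\<Sum>j<?h. mi_abs (?e j)) = mi_degree_sum CARD('d) n"
    using sum.reindex_bij_betw[OF bij_betw_mi_enum, of mi_abs n] by (simp add: sum_mi_abs)
  finally show ?thesis by (simp add: \<zeta>(2))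
qed

text \<open>
  Zaharjuta's theorem. After division by \<open>R\<close> the factor \<open>R ^ s\<close> of the self-improvement inequality
  disappears, and \<open>x N\<close> is bounded by \<open>x m\<close> to the power \<open>q ^ (d + 1) * l m / l N\<close>, with
  \<open>q = N div (m + d)\<close>. As \<open>l n\<close> is asymptotic to a multiple of \<open>n ^ (d + 1)\<close>, this exponent tends to a
  number \<open>\<eta> m\<close> for growing \<open>N\<close>, and \<open>\<eta> m\<close> tends to 1.
\<close>

theorem root_fekete_max_convergent:
  fixes E :: "(complex ^ 'd) set"
  assumes E: "compact E" "E \<noteq> {}"
  shows "convergent (\<lambda>n. root (mi_degree_sum CARD('d) n) (fekete_max n E))"
proof -
  let ?d = "CARD('d)"
  let ?l = "mi_degree_sum ?d"
  have d: "?d \<ge> 1" by (simp add: Suc_le_eq)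
  obtain R :: real where R: "R \<ge> 1" "\<And>z i. z \<in> E \<Longrightarrow> cmod (z $ i) \<le> R"
    by (rule bounded_coordinates[OF E(1)]) blast
  then have R0: "R > 0" by simp
  define x where "x n = root (?l n) (fekete_max n E) / R" for n
  define c where "c n = root (?l n) (fact (num_mi ?d n))" for n
  define \<theta> where "\<theta> m N = real ((N div (m + ?d)) ^ (?d + 1) * ?l m) / real (?l N)" for m N
  define \<eta> where "\<eta> m = (real (?l m) / real m ^ (?d + 1)) * (real m / real (m + ?d)) ^ (?d + 1) /
    (real ?d / fact (?d + 1))" for m
  have c: "c \<longlonglongrightarrow> 1" unfolding c_def using d by (rule root_fact_num_mi_tendsto_1)
  have x0: "x n \<ge> 0" for n
    using R0 fekete_max_nonneg[OF E] by (cases "?l n = 0") (auto simp: x_def)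
  have x_le: "x n \<le> \<bar>c n\<bar>" for n
  proof (cases "?l n = 0")
    case False
    have "root (?l n) (fekete_max n E) \<le> root (?l n) (fact (num_mi ?d n) * R ^ ?l n)"
      using False by (intro real_root_le_mono fekete_max_le E R) auto
    also have "\<dots> = c n * R"
      using False R0 by (simp add: real_root_mult c_def real_root_power_cancel)
    finally have "x n \<le> c n" using R0 by (simp add: x_def divide_le_eq)
    then show ?thesis by simp
  qed (simp add: x_def)
  obtain B where B: "\<And>n. \<bar>c n\<bar> \<le> B"
    using Bseq_def convergent_imp_Bseq[OF convergentI[OF c]] by (auto simp: Bseq_def)
  have "convergent x"
  proof (rule convergent_if_dominated_by_each_term[where B = B and c = c and \<theta> = \<theta> and \<eta> = \<eta>])
    show "x n \<in> {0..B}" for n using x0[of n] x_le[of n] B[of n] by simp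
    show "c \<longlonglongrightarrow> 1" by (rule c)
    show "\<eta> \<longlonglongrightarrow> 1"
    proof -
      have "(\<lambda>m. real m / real (m + ?d)) \<longlonglongrightarrow> 1" by real_asymp
      then have "\<eta> \<longlonglongrightarrow> (real ?d / fact (?d + 1)) * 1 ^ (?d + 1) / (real ?d / fact (?d + 1))"
        unfolding \<eta>_def using d
        by (intro tendsto_divide tendsto_mult tendsto_power mi_degree_sum_asymptotics tendsto_const) auto
      then show ?thesis using d by simp
    qed
    show "\<theta> m \<longlonglongrightarrow> \<eta> m" if m: "m \<ge> 1" for m
    proof -
      let ?k = "m + ?d"
      have lim: "(\<lambda>N. (real (N div ?k) / real N) ^ (?d + 1) * real (?l m) / (real (?l N) / real N ^ (?d + 1)))
        \<longlonglongrightarrow> (1 / real ?k) ^ (?d + 1) * real (?l m) / (real ?d / fact (?d + 1))"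
        using d m by (intro tendsto_divide tendsto_mult tendsto_power mi_degree_sum_asymptotics
            tendsto_const div_asymptotics) auto
      have eq: "(1 / real ?k) ^ (?d + 1) * real (?l m) / (real ?d / fact (?d + 1)) = \<eta> m"
        using m by (simp add: \<eta>_def power_divide del: power_Suc)
      have ev: "\<forall>\<^sub>F N in sequentially. (real (N div ?k) / real N) ^ (?d + 1) * real (?l m) /
          (real (?l N) / real N ^ (?d + 1)) = \<theta> m N"
        using eventually_gt_at_top[of 0]
        by eventually_elim (simp add: \<theta>_def power_divide del: power_Suc)
      from lim[unfolded eq] ev show ?thesis by (rule Lim_transform_eventually)
    qed
    show "\<forall>\<^sub>F N in sequentially. x N \<le> c N * x m powr \<theta> m N" if m: "m \<ge> 1" for m
      using eventually_ge_at_top[of "m + ?d"]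
    proof eventually_elim
      case (elim N)
      define q where "q = N div (m + ?d)"
      define Q where "Q = q ^ (?d + 1)"
      have q: "q \<ge> 1" "q * (m + ?d) \<le> N"
        using elim m by (auto simp: q_def Suc_le_eq div_greater_zero_iff)
      have l: "?l m > 0" "?l N > 0" using d m elim by (auto intro!: mi_degree_sum_pos)
      have Ql: "Q * ?l m > 0" using q(1) l by (simp add: Q_def)
      obtain s where s: "s + Q * ?l m = ?l N"
        and V: "fekete_max N E \<le> fact (num_mi ?d N) * (R ^ s * fekete_max m E ^ Q)"
      proof -
        have "\<exists>s. s + Q * ?l m = ?l N \<and>
            fekete_max N E \<le> fact (num_mi ?d N) * (R ^ s * fekete_max m E ^ Q)"
          unfolding Q_def by (rule fekete_max_self_improvement[OF E _ R0 q]) (rule R(2))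
        then show thesis using that by (elim exE conjE)
      qed
      have "fekete_max m E = (x m * R) ^ ?l m"
        using l R0 fekete_max_nonneg[OF E] by (simp add: x_def)
      then have "R ^ s * fekete_max m E ^ Q = x m ^ (Q * ?l m) * R ^ (s + Q * ?l m)"
        by (simp add: power_mult[symmetric] power_mult_distrib power_add mult_ac)
      with V have "fekete_max N E \<le> fact (num_mi ?d N) * (x m ^ (Q * ?l m) * R ^ ?l N)"
        by (simp add: s)
      then have "root (?l N) (fekete_max N E) \<le> root (?l N) (fact (num_mi ?d N) * (x m ^ (Q * ?l m) * R ^ ?l N))"
        using l by (intro real_root_le_mono) auto
      also have "\<dots> = c N * (x m powr (real (Q * ?l m) / real (?l N)) * R)"
        using l R0 root_power_eq_powr[OF l(2) Ql x0[of m]]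
        by (simp only: real_root_mult c_def real_root_power_cancel less_imp_le)
      also have "real (Q * ?l m) / real (?l N) = \<theta> m N"
        by (simp add: \<theta>_def Q_def q_def)
      finally show ?case using R0 by (simp add: x_def divide_le_eq mult.assoc)
    qed
  qed
  then have "convergent (\<lambda>n. x n * R)" by (intro convergent_mult convergent_const)
  then show ?thesis using R0 by (simp add: x_def)
qed

section \<open>Integer polynomials of small norm\<close>

text \<open>
  The determinant is linear in each row, so the modulus cannot grow when the rows are replaced, one
  after the other, by absolutely convex combinations of admissible rows.
\<close>

lemma det_of_rows_absolutely_convex:
  fixes f :: "nat \<Rightarrow> nat \<Rightarrow> complex"
  assumes S: "\<And>f. (\<And>i. i < n \<Longrightarrow> f i \<in> S) \<Longrightarrow> cmod (det_of n f) \<le> V"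
    and f: "\<And>i. i < n \<Longrightarrow> \<exists>a b u v. u \<in> S \<and> v \<in> S \<and> cmod a + cmod b \<le> 1 \<and> f i = (\<lambda>j. a * u j + b * v j)"
  shows "cmod (det_of n f) \<le> V"
proof -
  have "cmod (det_of n g) \<le> V" if "m \<le> n" "\<And>i. i < m \<Longrightarrow> g i = f i" "\<And>i. m \<le> i \<Longrightarrow> i < n \<Longrightarrow> g i \<in> S" for m g
    using that
  proof (induction m arbitrary: g)
    case 0
    then show ?case by (intro S) auto
  next
    case (Suc m)
    then obtain a b u v where uv: "u \<in> S" "v \<in> S" and ab: "cmod a + cmod b \<le> 1"
      and gm: "g m = (\<lambda>j. a * u j + b * v j)"
      using f[of m] by auto
    have IH: "cmod (det_of n (g(m := w))) \<le> V" if "w \<in> S" for w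
    proof (rule Suc.IH)
      show "(g(m := w)) i \<in> S" if "m \<le> i" "i < n" for i
        using that \<open>w \<in> S\<close> Suc.prems(3)[of i] by (cases "i = m") auto
    qed (use Suc.prems in auto)
    have "det_of n g = det_of n (g(m := \<lambda>j. a * u j + b * v j))"
      by (simp flip: gm)
    also have "\<dots> = a * det_of n (g(m := u)) + b * det_of n (g(m := v))"
      using Suc.prems(1) by (intro det_of_row_linear) simp
    finally have "cmod (det_of n g) \<le> cmod a * cmod (det_of n (g(m := u))) + cmod b * cmod (det_of n (g(m := v)))"
      by (metis norm_mult norm_triangle_ineq)
    also have "\<dots> \<le> cmod a * V + cmod b * V"
      by (intro add_mono mult_left_mono IH uv) auto
    also have "\<dots> \<le> V"
      using mult_right_mono[OF ab, of V] order_trans[OF norm_ge_zero IH[OF uv(1)]]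
      by (simp add: distrib_right)
    finally show ?case .
  qed
  from this[of n f] show ?thesis by simp
qed

lemma int_polys_eq_monomial_span: "int_polys n = monomial_span \<int> (multi_indices n)"
proof (intro equalityI subsetI)
  fix P :: "complex ^ 'd \<Rightarrow> complex" assume "P \<in> int_polys n"
  then obtain a :: "nat ^ 'd \<Rightarrow> int" where "P = (\<lambda>z. \<Sum>k\<in>multi_indices n. of_int (a k) * mpow z k)"
    unfolding int_polys_def mem_Collect_eq by (rule exE)
  then show "P \<in> monomial_span \<int> (multi_indices n)"
    by (intro monomial_spanI[of "\<lambda>k. of_int (a k)"]) simp_all
next
  fix P :: "complex ^ 'd \<Rightarrow> complex" assume "P \<in> monomial_span \<int> (multi_indices n)"
  then obtain c where cR: "\<forall>k. c k \<in> \<int>" and P: "P = (\<lambda>z. \<Sum>k\<in>multi_indices n. c k * mpow z k)"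
    unfolding monomial_span_def mem_Collect_eq by (elim exE conjE)
  have "\<forall>k. \<exists>m :: int. c k = of_int m"
    using cR unfolding Ints_def by auto
  from choice[OF this] obtain a :: "nat ^ 'd \<Rightarrow> int" where "\<forall>k. c k = of_int (a k)"
    by (rule exE)
  then show "P \<in> int_polys n"
    unfolding int_polys_def mem_Collect_eq P by (intro exI[of _ a]) simp
qed

lemma continuous_on_monomial_span:
  assumes "P \<in> monomial_span R S"
  shows "continuous_on E P"
proof -
  obtain c where "P = (\<lambda>z. \<Sum>k\<in>S. c k * mpow z k)"
    using assms unfolding monomial_span_def by auto
  then show ?thesis
    unfolding mpow_def by (auto intro!: continuous_intros continuous_on_component)
qed

lemma sup_norm_on_upper:
  assumes "compact E" "P \<in> monomial_span R S" "z \<in> E"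
  shows "cmod (P z) \<le> sup_norm_on E P"
  unfolding sup_norm_on_def
proof (rule cSUP_upper[OF assms(3)])
  have "continuous_on E (\<lambda>z. cmod (P z))"
    by (intro continuous_on_norm continuous_on_monomial_span[OF assms(2)])
  then have "compact ((\<lambda>z. cmod (P z)) ` E)" using assms(1) by (rule compact_continuous_image)
  then show "bdd_above ((\<lambda>z. cmod (P z)) ` E)"
    by (intro bounded_imp_bdd_above compact_imp_bounded)
qed

lemma sup_norm_on_nonneg:
  assumes "compact E" "E \<noteq> {}" "P \<in> monomial_span R S"
  shows "sup_norm_on E P \<ge> 0"
proof -
  obtain z where "z \<in> E" using assms(2) by blast
  from sup_norm_on_upper[OF assms(1,3) this] show ?thesis using norm_ge_zero order_trans by blast
qed

lemma int_chebyshev_n_le: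
  assumes "compact E" "E \<noteq> {}" "P \<in> int_polys n" "P \<noteq> (\<lambda>z. 0)" "\<And>z. z \<in> E \<Longrightarrow> cmod (P z) \<le> b"
  shows "int_chebyshev_n n E \<le> b"
proof -
  have "int_chebyshev_n n E \<le> sup_norm_on E P"
    unfolding int_chebyshev_n_def
  proof (rule cInf_lower)
    show "bdd_below {sup_norm_on E P |P. P \<in> int_polys n \<and> P \<noteq> (\<lambda>z. 0)}"
      by (rule bdd_belowI[of _ 0])
         (use sup_norm_on_nonneg[OF assms(1,2)] in \<open>auto simp: int_polys_eq_monomial_span\<close>)
  qed (use assms in blast)
  also have "\<dots> \<le> b"
    unfolding sup_norm_on_def using assms(2,5) by (rule cSUP_least)
  finally show ?thesis .
qed

lemma one_in_int_polys: "(\<lambda>z :: complex ^ 'd. 1) \<in> int_polys n"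
proof -
  have zero: "(0 :: nat ^ 'd) \<in> multi_indices n" by (simp add: multi_indices_def mi_abs_def)
  have "(\<lambda>z :: complex ^ 'd. mpow z 0) \<in> monomial_span \<int> (multi_indices n)"
    by (rule monomial_span_mono[OF monomial_span_mpow]) (use zero in auto)
  then show ?thesis by (simp add: int_polys_eq_monomial_span mpow_def)
qed

lemma le_int_chebyshev_n:
  fixes E :: "(complex ^ 'd) set"
  assumes "\<And>P. P \<in> int_polys n \<Longrightarrow> P \<noteq> (\<lambda>z. 0) \<Longrightarrow> b \<le> sup_norm_on E P"
  shows "b \<le> int_chebyshev_n n E"
  unfolding int_chebyshev_n_def
proof (rule cInf_greatest)
  have "(\<lambda>z :: complex ^ 'd. 1 :: complex) \<noteq> (\<lambda>z. 0)" by (auto simp: fun_eq_iff)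
  then show "{sup_norm_on E P |P. P \<in> int_polys n \<and> P \<noteq> (\<lambda>z. 0)} \<noteq> {}"
    using one_in_int_polys by blast
qed (use assms in auto)

lemma int_chebyshev_n_nonneg: 
  assumes "compact E" "E \<noteq> {}"
  shows "int_chebyshev_n n E \<ge> 0"
  by (rule le_int_chebyshev_n) (auto simp: int_polys_eq_monomial_span intro: sup_norm_on_nonneg[OF assms])

lemma int_polys_power:
  assumes "P \<in> int_polys m" "q * m \<le> N"
  shows "(\<lambda>z. P z ^ q) \<in> int_polys N"
proof -
  have "(\<lambda>z. P z ^ q) \<in> int_polys (q * m)"
  proof (induction q)
    case 0
    then show ?case using one_in_int_polys by simp
  next
    case (Suc q)
    have "(\<lambda>z. P z * P z ^ q) \<in> monomial_span \<int> (multi_indices (Suc q * m))"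
      by (rule monomial_span_mult[OF finite_multi_indices finite_multi_indices finite_multi_indices _ _ _ _
            assms(1)[unfolded int_polys_eq_monomial_span] Suc[unfolded int_polys_eq_monomial_span]])
         (auto simp: multi_indices_def mi_abs_add)
    then show ?case by (simp add: int_polys_eq_monomial_span)
  qed
  then show ?thesis
    unfolding int_polys_eq_monomial_span using assms(2)
    by (elim monomial_span_mono) (auto intro: multi_indices_mono)
qed

text \<open>
  Powers of a single polynomial suffice to compare different degrees; that such a power is nonzero
  is clear from its values.
\<close>

lemma int_chebyshev_n_power:
  fixes E :: "(complex ^ 'd) set"
  assumes E: "compact E" "E \<noteq> {}" and q: "q \<ge> 1" "q * m \<le> N"
  shows "int_chebyshev_n N E \<le> int_chebyshev_n m E ^ q"
proof -
  have "root q (int_chebyshev_n N E) \<le> int_chebyshev_n m E"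
  proof (rule le_int_chebyshev_n)
    fix P :: "complex ^ 'd \<Rightarrow> complex" assume P: "P \<in> int_polys m" "P \<noteq> (\<lambda>z. 0)"
    have PE: "sup_norm_on E P \<ge> 0" "\<And>z. z \<in> E \<Longrightarrow> cmod (P z) \<le> sup_norm_on E P"
      using P(1) by (auto simp: int_polys_eq_monomial_span intro: sup_norm_on_nonneg[OF E] sup_norm_on_upper[OF E(1)])
    obtain z0 where "P z0 \<noteq> 0" using P(2) by (auto simp: fun_eq_iff)
    then have "P z0 ^ q \<noteq> 0" by simp
    then have "(\<lambda>z. P z ^ q) \<noteq> (\<lambda>z. 0)" by (metis (mono_tags))
    from int_chebyshev_n_le[OF E int_polys_power[OF P(1) q(2)] this, of "sup_norm_on E P ^ q"]
    have "int_chebyshev_n N E \<le> sup_norm_on E P ^ q"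
      using PE(2) by (simp add: norm_power power_mono)
    then have "root q (int_chebyshev_n N E) \<le> root q (sup_norm_on E P ^ q)"
      using q(1) by (intro real_root_le_mono) auto
    then show "root q (int_chebyshev_n N E) \<le> sup_norm_on E P"
      using q(1) PE(1) by (simp add: real_root_power_cancel)
  qed
  then have "root q (int_chebyshev_n N E) ^ q \<le> int_chebyshev_n m E ^ q"
    using q(1) int_chebyshev_n_nonneg[OF E] by (intro power_mono) auto
  then show ?thesis using q(1) int_chebyshev_n_nonneg[OF E] by simp
qed

lemma root_int_chebyshev_n_convergent:
  fixes E :: "(complex ^ 'd) set"
  assumes E: "compact E" "E \<noteq> {}"
  shows "convergent (\<lambda>n. root n (int_chebyshev_n n E))"
proof (rule convergent_if_dominated_by_each_term[where B = 1 and c = "\<lambda>_. 1" and \<eta> = "\<lambda>_. 1"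
      and \<theta> = "\<lambda>m N. real (m * (N div m)) / real N"])
  let ?x = "\<lambda>n. root n (int_chebyshev_n n E)"
  show "?x n \<in> {0..1}" for n
  proof -
    have "int_chebyshev_n n E \<le> 1"
      using one_in_int_polys by (rule int_chebyshev_n_le[OF E]) (auto simp: fun_eq_iff)
    then show ?thesis using int_chebyshev_n_nonneg[OF E, of n] by (cases "n = 0") auto
  qed
  show "(\<lambda>N. real (m * (N div m)) / real N) \<longlonglongrightarrow> 1" if "m \<ge> 1" for m
    using tendsto_mult[OF tendsto_const[of "real m"] div_asymptotics[of m]] that by simp
  show "\<forall>\<^sub>F N in sequentially. ?x N \<le> 1 * ?x m powr (real (m * (N div m)) / real N)" if m: "m \<ge> 1" for m
    using eventually_ge_at_top[of m]
  proof eventually_elim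
    case (elim N)
    define q where "q = N div m"
    have q: "q \<ge> 1" "q * m \<le> N" using elim m by (auto simp: q_def Suc_le_eq div_greater_zero_iff)
    have "?x N \<le> root N (int_chebyshev_n m E ^ q)"
      using elim m by (intro real_root_le_mono int_chebyshev_n_power[OF E q]) auto
    also have "int_chebyshev_n m E ^ q = ?x m ^ (m * q)"
      using m int_chebyshev_n_nonneg[OF E] by (simp add: power_mult)
    also have "root N (?x m ^ (m * q)) = ?x m powr (real (m * q) / real N)"
      using elim m q(1) int_chebyshev_n_nonneg[OF E] by (intro root_power_eq_powr) auto
    finally show ?case by (simp add: q_def)
  qed
qed auto

lemma conj_invariant_all:
  assumes "conj_invariant E" "z \<in> E"
  shows "(\<chi> i. cnj (z $ i)) \<in> E"
proof -
  have "(\<chi> i. if i \<in> S then cnj (z $ i) else z $ i) \<in> E" if "finite S" for S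
    using that
  proof (induction S rule: finite_induct)
    case empty
    then show ?case using assms(2) by simp
  next
    case (insert j S)
    have "conj_coord j (\<chi> i. if i \<in> S then cnj (z $ i) else z $ i) \<in> E"
      using assms(1) insert.IH by (simp add: conj_invariant_def)
    moreover have "conj_coord j (\<chi> i. if i \<in> S then cnj (z $ i) else z $ i) =
        (\<chi> i. if i \<in> insert j S then cnj (z $ i) else z $ i)"
      using insert.hyps by (auto simp: conj_coord_def Finite_Cartesian_Product.vec_eq_iff)
    ultimately show ?case by simp
  qed
  from this[of UNIV] show ?thesis by simp
qed

lemma mpow_cnj: "mpow (\<chi> i. cnj (z $ i)) k = cnj (mpow z k)"
  by (simp add: mpow_def)

text \<open>
  The real part of a monomial value at \<open>z\<close> is the mean of the values at \<open>z\<close> and at its conjugate, which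
  is a point of \<open>E\<close> again, and similarly for the imaginary part with the factors \<open>- \<i>\<close> and \<open>\<i>\<close>. The
  rows are thus absolutely convex combinations of rows of Vandermonde matrices on \<open>E\<close>. The zero row
  is what the unit vectors added in \<open>small_integer_combination\<close> become after division by \<open>q\<close>, in
  the limit.
\<close>

lemma det_of_real_forms_le_fekete_max:
  fixes E :: "(complex ^ 'd) set" and f :: "nat \<Rightarrow> nat \<Rightarrow> real"
  assumes E: "compact E" "E \<noteq> {}" "conj_invariant E"
    and f: "\<And>i. i < num_mi CARD('d) n \<Longrightarrow> f i \<in> insert (\<lambda>_. 0)
      ((\<lambda>z j. Re (mpow z (mi_enum n j))) ` E \<union> (\<lambda>z j. Im (mpow z (mi_enum n j))) ` E)"
  shows "\<bar>det_of (num_mi CARD('d) n) f\<bar> \<le> fekete_max n E"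
proof -
  let ?h = "num_mi CARD('d) n"
  let ?v = "\<lambda>z j. mpow (z :: complex ^ 'd) (mi_enum n j)"
  have "cmod (det_of ?h (\<lambda>i j. complex_of_real (f i j))) \<le> fekete_max n E"
  proof (rule det_of_rows_absolutely_convex[where S = "?v ` E"])
    fix g :: "nat \<Rightarrow> nat \<Rightarrow> complex" assume "\<And>i. i < ?h \<Longrightarrow> g i \<in> ?v ` E"
    then have "\<forall>i\<in>{..<?h}. \<exists>z. z \<in> E \<and> g i = ?v z" by auto
    from bchoice[OF this] obtain z where z: "\<And>i. i < ?h \<Longrightarrow> z i \<in> E" "\<And>i. i < ?h \<Longrightarrow> g i = ?v (z i)"
      by auto
    have "det_of ?h g = vdm ?h (mi_enum n) z"
      unfolding vdm_def by (rule det_of_cong) (simp add: z(2))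
    also have "cmod \<dots> \<le> fekete_max n E"
      unfolding fekete_max_def by (rule max_vdm_attained[OF E(1,2), of ?h "mi_enum n"]) (use z(1) in simp)
    finally show "cmod (det_of ?h g) \<le> fekete_max n E" .
  next
    fix i assume "i < ?h"
    let ?goal = "\<exists>a b u v. u \<in> ?v ` E \<and> v \<in> ?v ` E \<and> cmod a + cmod b \<le> 1 \<and>
        (\<lambda>j. complex_of_real (f i j)) = (\<lambda>j. a * u j + b * v j)"
    have goalI: ?goal if "z \<in> E" "z' \<in> E" "cmod a + cmod b \<le> 1"
      "\<And>j. complex_of_real (f i j) = a * ?v z j + b * ?v z' j" for a b z z'
      by (rule exI[of _ a], rule exI[of _ b], rule exI[of _ "?v z"], rule exI[of _ "?v z'"])
         (use that in auto)
    from f[OF \<open>i < ?h\<close>] consider "f i = (\<lambda>_. 0)"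
      | z where "z \<in> E" "f i = (\<lambda>j. Re (?v z j))" | z where "z \<in> E" "f i = (\<lambda>j. Im (?v z j))"
      by auto
    then show ?goal
    proof cases
      case 1
      obtain z where "z \<in> E" using E(2) by blast
      then show ?thesis using 1 by (intro goalI[of z z 0 0]) auto
    next
      case (2 z)
      have "complex_of_real (f i j) = 1 / 2 * ?v z j + 1 / 2 * ?v (\<chi> i. cnj (z $ i)) j" for j
        by (simp add: 2(2) mpow_cnj complex_eq_iff)
      then show ?thesis
        by (intro goalI[OF 2(1) conj_invariant_all[OF E(3) 2(1)], of "1 / 2" "1 / 2"]) auto
    next
      case (3 z)
      have "complex_of_real (f i j) = (- \<i> / 2) * ?v z j + (\<i> / 2) * ?v (\<chi> i. cnj (z $ i)) j" for j
        by (simp add: 3(2) mpow_cnj complex_eq_iff)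
      then show ?thesis
        by (intro goalI[OF 3(1) conj_invariant_all[OF E(3) 3(1)], of "- \<i> / 2" "\<i> / 2"])
           (auto simp: norm_divide)
    qed
  qed
  then show ?thesis by (simp add: det_of_of_real)
qed

text \<open>
  An integer vector that makes the real and imaginary parts of all evaluations at points of \<open>E\<close> small
  is the coefficient vector of the polynomial sought. The bound is first obtained with any number
  \<open>D\<close> greater than \<open>fekete_max n E\<close> in its place, which covers the case that \<open>fekete_max n E\<close> is zero.
\<close>

lemma int_chebyshev_n_le_fekete_max:
  fixes E :: "(complex ^ 'd) set" and n :: nat
  assumes E: "compact E" "E \<noteq> {}" "conj_invariant E"
  defines "h \<equiv> num_mi CARD('d) n"
  shows "int_chebyshev_n n E \<le> 4 * real h ^ 2 * root h (fekete_max n E)"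
proof -
  let ?e = "mi_enum n :: nat \<Rightarrow> nat ^ 'd"
  let ?re = "\<lambda>z j. Re (mpow (z :: complex ^ 'd) (?e j))"
  let ?im = "\<lambda>z j. Im (mpow (z :: complex ^ 'd) (?e j))"
  let ?K = "?re ` E \<union> ?im ` E"
  have h: "h > 0" unfolding h_def by (rule num_mi_pos)
  have e: "bij_betw ?e {..<h} (multi_indices n)" unfolding h_def by (rule bij_betw_mi_enum)
  obtain R :: real where R: "R \<ge> 1" "\<And>z i. z \<in> E \<Longrightarrow> cmod (z $ i) \<le> R"
    by (rule bounded_coordinates[OF E(1)]) blast
  have K_le: "\<bar>v j\<bar> \<le> R ^ n" if "v \<in> ?K" "j < h" for v j
  proof -
    obtain z where z: "z \<in> E" "v = ?re z \<or> v = ?im z" using \<open>v \<in> ?K\<close> by auto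
    have "mi_abs (?e j) \<le> n" using bij_betwE[OF e] \<open>j < h\<close> by (auto simp: multi_indices_def)
    then have "R ^ mi_abs (?e j) \<le> R ^ n" using R(1) by (rule power_increasing)
    moreover have "cmod (mpow z (?e j)) \<le> R ^ mi_abs (?e j)"
      by (rule cmod_mpow_le) (rule R(2)[OF z(1)])
    moreover have "\<bar>v j\<bar> \<le> cmod (mpow z (?e j))"
      using z(2) abs_Re_le_cmod[of "mpow z (?e j)"] abs_Im_le_cmod[of "mpow z (?e j)"] by auto
    ultimately show ?thesis by linarith
  qed
  have bound: "int_chebyshev_n n E \<le> 4 * real h ^ 2 * root h D" if D: "fekete_max n E < D" for D
  proof -
    have "\<exists>x :: nat \<Rightarrow> int. (\<exists>j<h. x j \<noteq> 0) \<and>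
        (\<forall>v\<in>?K. \<bar>\<Sum>j<h. v j * of_int (x j)\<bar> \<le> 2 * real h ^ 2 * root h D)"
    proof (rule small_integer_combination[OF h _ _ D])
      show "\<bar>v j\<bar> \<le> R ^ n" if "v \<in> ?K" "j < h" for v j using that by (rule K_le)
      show "\<bar>det_of h f\<bar> \<le> fekete_max n E" if "\<And>i. i < h \<Longrightarrow> f i \<in> insert (\<lambda>_. 0) ?K" for f
        unfolding h_def by (rule det_of_real_forms_le_fekete_max[OF E]) (use that h_def in blast)
    qed
    then obtain x :: "nat \<Rightarrow> int" and j0 where j0: "j0 < h" "x j0 \<noteq> 0"
      and x: "\<forall>v\<in>?K. \<bar>\<Sum>j<h. v j * of_int (x j)\<bar> \<le> 2 * real h ^ 2 * root h D"
      by (elim exE conjE) (rule that)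
    define a where "a k = x (inv_into {..<h} ?e k)" for k
    have a: "a (?e j) = x j" if "j < h" for j
      using that bij_betw_inv_into_left[OF e] by (simp add: a_def)
    define P where "P = (\<lambda>z :: complex ^ 'd. \<Sum>k\<in>multi_indices n. of_int (a k) * mpow z k)"
    have "P \<in> int_polys n" by (auto simp: P_def int_polys_def)
    moreover have "P \<noteq> (\<lambda>z. 0)"
      unfolding P_def
      by (rule combination_of_monomials_nonzero[of "?e j0"])
         (use j0 a bij_betwE[OF e] in auto)
    moreover have "cmod (P z) \<le> 4 * real h ^ 2 * root h D" if z: "z \<in> E" for z
    proof -
      have "P z = (\<Sum>j<h. of_int (a (?e j)) * mpow z (?e j))"
        unfolding P_def by (rule sum.reindex_bij_betw[OF e, symmetric])
      also have "\<dots> = (\<Sum>j<h. of_int (x j) * mpow z (?e j))"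
        by (intro sum.cong) (auto simp: a)
      finally have Pz: "P z = (\<Sum>j<h. of_int (x j) * mpow z (?e j))" .
      have "Re (P z) = (\<Sum>j<h. ?re z j * of_int (x j))" "Im (P z) = (\<Sum>j<h. ?im z j * of_int (x j))"
        by (simp_all add: Pz mult.commute)
      moreover have "\<bar>\<Sum>j<h. ?re z j * of_int (x j)\<bar> \<le> 2 * real h ^ 2 * root h D"
        by (rule bspec[OF x]) (use z in auto)
      moreover have "\<bar>\<Sum>j<h. ?im z j * of_int (x j)\<bar> \<le> 2 * real h ^ 2 * root h D"
        by (rule bspec[OF x]) (use z in auto)
      ultimately show ?thesis using cmod_le[of "P z"] by linarith
    qed
    ultimately show ?thesis by (rule int_chebyshev_n_le[OF E(1,2)])
  qed
  have "(\<lambda>k. 4 * real h ^ 2 * root h (fekete_max n E + 1 / real (Suc k)))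
      \<longlonglongrightarrow> 4 * real h ^ 2 * root h (fekete_max n E + 0)"
    by (intro tendsto_mult tendsto_const tendsto_real_root tendsto_add LIMSEQ_Suc lim_1_over_n)
  moreover have "int_chebyshev_n n E \<le> 4 * real h ^ 2 * root h (fekete_max n E + 1 / real (Suc k))" for k
    by (rule bound) simp
  ultimately show ?thesis by (intro LIMSEQ_le_const[where x = "4 * real h ^ 2 * root h (fekete_max n E)"]) auto
qed

theorem theorem3p1:
  fixes E :: "(complex ^ 'd) set"
  assumes "compact E" and "E \<noteq> {}" and "conj_invariant E"
  shows "int_chebyshev E \<le> transfinite_diameter E powr (real CARD('d) / (real CARD('d) + 1))"
proof -
  let ?d = "CARD('d)" and ?l = "mi_degree_sum CARD('d)"
  let ?x = "\<lambda>n. root n (int_chebyshev_n n E)"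
  let ?y = "\<lambda>n. root (?l n) (fekete_max n E)"
  have d: "?d \<ge> 1" by (simp add: Suc_le_eq)
  have x: "?x \<longlonglongrightarrow> int_chebyshev E"
    using root_int_chebyshev_n_convergent[OF assms(1,2)]
    by (simp add: int_chebyshev_def convergent_LIMSEQ_iff)
  have y: "?y \<longlonglongrightarrow> transfinite_diameter E"
    using root_fekete_max_convergent[OF assms(1,2)]
    by (simp add: transfinite_diameter_def vandermonde_fekete[OF assms(1,2)] fekete_max_def
        convergent_LIMSEQ_iff)
  have y0: "?y n \<ge> 0" for n
    using fekete_max_nonneg[OF assms(1,2), of n] by (cases "?l n = 0") auto
  have "(\<lambda>n. root n 4 * root n (num_mi ?d n) ^ 2 * ?y n powr (real ?d / (real ?d + 1)))
      \<longlonglongrightarrow> 1 * 1 ^ 2 * transfinite_diameter E powr (real ?d / (real ?d + 1))"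
    using y0 by (intro tendsto_mult tendsto_power tendsto_powr2 LIMSEQ_root_const num_mi_root_tendsto_1 y
        tendsto_const) auto
  then have rhs: "(\<lambda>n. root n 4 * root n (num_mi ?d n) ^ 2 * ?y n powr (real ?d / (real ?d + 1)))
      \<longlonglongrightarrow> transfinite_diameter E powr (real ?d / (real ?d + 1))" by simp
  have "?x n \<le> root n 4 * root n (num_mi ?d n) ^ 2 * ?y n powr (real ?d / (real ?d + 1))" if n: "n \<ge> 1" for n
  proof -
    have "?x n \<le> root n (4 * real (num_mi ?d n) ^ 2 * root (num_mi ?d n) (fekete_max n E))"
      using n by (intro real_root_le_mono int_chebyshev_n_le_fekete_max assms) auto
    also have "\<dots> = root n 4 * root n (num_mi ?d n) ^ 2 * root n (root (num_mi ?d n) (fekete_max n E))"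
      using n by (simp add: real_root_mult real_root_power)
    also have "root n (root (num_mi ?d n) (fekete_max n E)) = ?y n powr (real ?d / (real ?d + 1))"
      using d n fekete_max_nonneg[OF assms(1,2)] by (rule root_mi_degree_sum)
    finally show ?thesis .
  qed
  then show ?thesis by (intro LIMSEQ_le[OF x rhs]) auto
qed

end
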